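(* Let $R\subseteq T$ be rings forming a regular conductor square with conductor $C$, and set $A=R/C$, $B=T/C$. Assume that $T$ is flat as an $R$-module, that $C$ is a principal ideal of $T$, and that every non-zero finitely generated ideal $I$ of $R$ satisfies the following condition: there are elements $r,s\in R$ and an ideal $U\subseteq R$ such that $UT=T=rT$ and $rI=sU$, and such that the multiplication maps $I\xrightarrow{r}rI$ and $U\xrightarrow{s}sU$ are isomorphisms. Assume that $A$ is a finite product of integral domains. Then $R$ is quasi-coherent if and only if $A$ is quasi-coherent; these conditions imply that $T$ is also quasi-coherent.
   Context: All rings are commutative with identity. A conductor square consists of a ring $T$, a subring $R\subseteq T$ such that $R$ and $T$ have a common non-zero ideal, the largest common ideal $C$ of $R$ and $T$ (called the conductor of $T$ into $R$), and the rings $A=R/C$ and $B=T/C$, together with the inclusions $R\hookrightarrow T$, $A\hookrightarrow B$ and the projections $\eta_2\colon R\twoheadrightarrow A$, $\eta_1\colon T\twoheadrightarrow B$; equivalently, $R$ is the pullback $\{(a,t)\in A\times T\mid a=\eta_1(t)\text{ in }B\}$ and $C=\operatorname{Ker}(\eta_1)=\operatorname{Ker}(\eta_2)$ is the largest common ideal. The square is regular if $C$ contains a non-zero-divisor of $T$. A ring $S$ is quasi-coherent if every ideal of the form $(0:_S a)=\{x\in S\mid xa=0\}$ with $a\in S$ is finitely generated, and every intersection of finitely many principal ideals of $S$ is finitely generated. *)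

theory Defs
  imports "HOL-Algebra.Algebra"
begin

section \<open>Conductor squares\<close>

text \<open>The ring \<open>R\<close> is a record of its own; the equation in \<open>sub_ops\<close> says that its operations
  are those of \<open>T\<close>. The other two corners of the square are \<open>R Quot C\<close> and \<open>T Quot C\<close>.\<close>

locale conductor_square =
  fixes T :: "('a, 'b) ring_scheme" and R :: "('a, 'b) ring_scheme" and C :: "'a set"
  assumes cring_T: "cring T"
    and sub_carrier: "subring (carrier R) T"
    and sub_ops: "R = T\<lparr>carrier := carrier R\<rparr>"
    and ideal_R: "ideal C R"
    and ideal_T: "ideal C T"
    and nonzero: "C \<noteq> {\<zero>\<^bsub>T\<^esub>}"
    and largest: "\<And>J. ideal J R \<Longrightarrow> ideal J T \<Longrightarrow> J \<subseteq> C"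

definition non_zero_divisor :: "('a, 'b) ring_scheme \<Rightarrow> 'a \<Rightarrow> bool" where
  "non_zero_divisor S c \<longleftrightarrow>
     c \<in> carrier S \<and> (\<forall>x\<in>carrier S. c \<otimes>\<^bsub>S\<^esub> x = \<zero>\<^bsub>S\<^esub> \<longrightarrow> x = \<zero>\<^bsub>S\<^esub>)"

locale regular_conductor_square = conductor_square +
  assumes regular: "\<exists>c\<in>C. non_zero_divisor T c"


section \<open>Quasi-coherent rings\<close>

definition fin_gen_ideal :: "('a, 'b) ring_scheme \<Rightarrow> 'a set \<Rightarrow> bool" where
  "fin_gen_ideal S I \<longleftrightarrow> (\<exists>F\<subseteq>carrier S. finite F \<and> I = Idl\<^bsub>S\<^esub> F)"

text \<open>The empty intersection, which is the unit ideal, is left out since \<open>\<Inter>{}\<close> would be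
  \<open>UNIV\<close>.\<close>

definition quasi_coherent :: "('a, 'b) ring_scheme \<Rightarrow> bool" where
  "quasi_coherent S \<longleftrightarrow>
     (\<forall>a\<in>carrier S. fin_gen_ideal S {x \<in> carrier S. x \<otimes>\<^bsub>S\<^esub> a = \<zero>\<^bsub>S\<^esub>}) \<and>
     (\<forall>F\<subseteq>carrier S. finite F \<and> F \<noteq> {} \<longrightarrow> fin_gen_ideal S (\<Inter>a\<in>F. PIdl\<^bsub>S\<^esub> a))"


section \<open>Modules\<close>

definition module_hom ::
  "('a, 'r) ring_scheme \<Rightarrow> ('a, 'm, 'x) module_scheme \<Rightarrow> ('a, 'n, 'y) module_scheme \<Rightarrow> ('m \<Rightarrow> 'n) set"
where
  "module_hom R M N =
     {f \<in> carrier M \<rightarrow> carrier N.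
        (\<forall>x\<in>carrier M. \<forall>y\<in>carrier M. f (x \<oplus>\<^bsub>M\<^esub> y) = f x \<oplus>\<^bsub>N\<^esub> f y) \<and>
        (\<forall>a\<in>carrier R. \<forall>x\<in>carrier M. f (a \<odot>\<^bsub>M\<^esub> x) = a \<odot>\<^bsub>N\<^esub> f x)}"

definition module_iso ::
  "('a, 'r) ring_scheme \<Rightarrow> ('a, 'm, 'x) module_scheme \<Rightarrow> ('a, 'n, 'y) module_scheme \<Rightarrow> ('m \<Rightarrow> 'n) set"
where
  "module_iso R M N = {f \<in> module_hom R M N. bij_betw f (carrier M) (carrier N)}"

text \<open>An additive subgroup \<open>I\<close> of \<open>S\<close>, seen as a module with scalars acting through the
  multiplication of \<open>S\<close>: an ideal \<open>I\<close> of \<open>S\<close>, or \<open>I = carrier S\<close> over a subring of \<open>S\<close>.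
  (The record type for modules also has the fields \<open>mult\<close> and \<open>one\<close>, which are irrelevant
  for modules.)\<close>

definition mult_module :: "('a, 'b) ring_scheme \<Rightarrow> 'a set \<Rightarrow> ('a, 'a) module" where
  "mult_module S I =
     \<lparr>carrier = I, monoid.mult = (\<otimes>\<^bsub>S\<^esub>), one = \<one>\<^bsub>S\<^esub>, ring.zero = \<zero>\<^bsub>S\<^esub>, ring.add = (\<oplus>\<^bsub>S\<^esub>),
      smult = (\<otimes>\<^bsub>S\<^esub>)\<rparr>"


section \<open>Tensor products and flatness\<close>

text \<open>\<open>M \<otimes>\<^sub>R P\<close> is the free abelian group on \<open>M \<times> P\<close> modulo the subgroup generated by the
  bilinearity relations.\<close>

definition tensor_gens ::
  "('a, 'r) ring_scheme \<Rightarrow> ('a, 'm, 'x) module_scheme \<Rightarrow> ('a, 'p, 'y) module_scheme \<Rightarrow>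
    ('m \<times> 'p \<Rightarrow>\<^sub>0 int) set"
where
  "tensor_gens R M P =
     {frag_of (x \<oplus>\<^bsub>M\<^esub> y, p) - frag_of (x, p) - frag_of (y, p) | x y p.
        x \<in> carrier M \<and> y \<in> carrier M \<and> p \<in> carrier P} \<union>
     {frag_of (x, p \<oplus>\<^bsub>P\<^esub> q) - frag_of (x, p) - frag_of (x, q) | x p q.
        x \<in> carrier M \<and> p \<in> carrier P \<and> q \<in> carrier P} \<union>
     {frag_of (a \<odot>\<^bsub>M\<^esub> x, p) - frag_of (x, a \<odot>\<^bsub>P\<^esub> p) | a x p.
        a \<in> carrier R \<and> x \<in> carrier M \<and> p \<in> carrier P}"

definition tensor_rel ::
  "('a, 'r) ring_scheme \<Rightarrow> ('a, 'm, 'x) module_scheme \<Rightarrow> ('a, 'p, 'y) module_scheme \<Rightarrow>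
    ('m \<times> 'p \<Rightarrow>\<^sub>0 int) set"
where
  "tensor_rel R M P =
     generate (free_Abelian_group (carrier M \<times> carrier P)) (tensor_gens R M P)"

definition tensor_product ::
  "('a, 'r) ring_scheme \<Rightarrow> ('a, 'm, 'x) module_scheme \<Rightarrow> ('a, 'p, 'y) module_scheme \<Rightarrow>
    ('m \<times> 'p \<Rightarrow>\<^sub>0 int) set monoid"
where
  "tensor_product R M P =
     free_Abelian_group (carrier M \<times> carrier P) Mod tensor_rel R M P"

text \<open>The map \<open>f \<otimes> id\<^sub>P\<close> from \<open>M \<otimes>\<^sub>R P\<close> to \<open>N \<otimes>\<^sub>R P\<close> for \<open>f\<close> from \<open>M\<close> to \<open>N\<close>: the image of
  a coset \<open>Q\<close> under the map \<open>(x, p) \<mapsto> (f x, p)\<close> of free abelian groups lies in a single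
  coset, which is obtained by adding the relations of \<open>N \<otimes>\<^sub>R P\<close>.\<close>

definition tensor_map ::
  "('a, 'r) ring_scheme \<Rightarrow> ('a, 'n, 'x) module_scheme \<Rightarrow> ('a, 'p, 'y) module_scheme \<Rightarrow>
    ('m \<Rightarrow> 'n) \<Rightarrow> ('m \<times> 'p \<Rightarrow>\<^sub>0 int) set \<Rightarrow> ('n \<times> 'p \<Rightarrow>\<^sub>0 int) set"
where
  "tensor_map R N P f Q =
     tensor_rel R N P <#>\<^bsub>free_Abelian_group (carrier N \<times> carrier P)\<^esub>
       (frag_extend (\<lambda>(x, p). frag_of (f x, p)) ` Q)"

text \<open>\<open>P\<close> is flat if tensoring with \<open>P\<close> preserves injectivity. A formula cannot range over
  modules of all types, so their type \<open>'m\<close> is a parameter. By the ideal criterion for flatness it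
  is enough to test the inclusions of the ideals of \<open>R\<close> into \<open>R\<close>; hence the instance where \<open>'m\<close>
  is the type of the elements of \<open>R\<close> is the usual notion, and flatness for every other \<open>'m\<close>
  follows from it.\<close>

definition flat_module ::
  "'m itself \<Rightarrow> ('a, 'r) ring_scheme \<Rightarrow> ('a, 'p, 'x) module_scheme \<Rightarrow> bool"
where
  "flat_module _ R P \<longleftrightarrow>
     module R P \<and>
     (\<forall>(M :: ('a, 'm) module) (N :: ('a, 'm) module) f.
        module R M \<and> module R N \<and> f \<in> module_hom R M N \<and> inj_on f (carrier M) \<longrightarrow>
        inj_on (tensor_map R N P f) (carrier (tensor_product R M P)))"

end

theory Submission
  imports Defs
begin

text \<open>Applied to principal ideals, the condition on finitely generated ideals shows that every
  non-zero element of \<open>R\<close> is a non-zero-divisor; hence \<open>T\<close> and \<open>R\<close> are domains. Applied to the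
  ideal spanned by the inverses (up to a common factor) of non-zero elements \<open>a\<close> in a finite set
  \<open>F\<close>, it yields \<open>u a\<close> in \<open>R\<close> that generate the unit ideal of \<open>T\<close> such that \<open>a u a = w\<close> does
  not depend on \<open>a\<close>. Then \<open>\<Inter> a T = w T\<close>, so \<open>T\<close> is quasi-coherent, and \<open>\<Inter> a R = w V\<close> where
  \<open>V\<close> is the set of the \<open>y\<close> in \<open>T\<close> with \<open>y u a \<in> R\<close> for all \<open>a\<close>.

  If the \<open>a\<close> are non-zero-divisors modulo \<open>C\<close>, then \<open>\<Inter> a A\<close> is the image of \<open>\<Inter> a R\<close>. As \<open>A\<close> is
  a product of domains, these intersections determine quasi-coherence of \<open>A\<close>. Conversely, the
  ideal of \<open>R\<close> generated by the \<open>u a\<close> contains some \<open>d\<close> that is a non-zero-divisor modulo \<open>C\<close>,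
  and \<open>y \<mapsto> d y\<close> identifies \<open>V / C\<close> with the ideal of the \<open>z\<close> in \<open>A\<close> with \<open>u a z \<in> d A\<close> for
  all \<open>a\<close>. If \<open>A\<close> is quasi-coherent, this ideal is finitely generated, and since \<open>1 \<in> V\<close> and
  \<open>C \<subseteq> R\<close>, so is the \<open>R\<close>-module \<open>V\<close>.\<close>

section \<open>Ideals and non-zero-divisors\<close>

lemma (in cring) ideal_closedI:
  assumes "J \<subseteq> carrier R" "\<zero> \<in> J"
    and "\<And>x y. x \<in> J \<Longrightarrow> y \<in> J \<Longrightarrow> x \<oplus> y \<in> J"
    and mult: "\<And>r x. r \<in> carrier R \<Longrightarrow> x \<in> J \<Longrightarrow> r \<otimes> x \<in> J"
  shows "ideal J R"
proof (rule idealI)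
  have "\<ominus> x \<in> J" if "x \<in> J" for x
  proof -
    have "\<ominus> x = \<ominus> \<one> \<otimes> x"
      using that assms(1) by (simp add: l_minus subset_iff)
    then show ?thesis
      using mult[OF _ that, of "\<ominus> \<one>"] by simp
  qed
  then show "subgroup J (add_monoid R)"
    using assms by unfold_locales (auto simp: a_inv_def)
  show "x \<otimes> a \<in> J" "a \<otimes> x \<in> J" if "a \<in> J" "x \<in> carrier R" for a x
    using mult[of x a] that assms(1) by (auto simp: m_comm[of a x] subset_iff)
qed (rule ring_axioms)

lemma (in cring) genideal_closed:
  assumes "F \<subseteq> carrier R"
  shows "\<zero> \<in> Idl F"
    and "x \<in> Idl F \<Longrightarrow> y \<in> Idl F \<Longrightarrow> x \<oplus> y \<in> Idl F"
    and "r \<in> carrier R \<Longrightarrow> x \<in> Idl F \<Longrightarrow> r \<otimes> x \<in> Idl F"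
    and "x \<in> Idl F \<Longrightarrow> x \<in> carrier R"
proof -
  interpret I: ideal "Idl F" R
    using assms by (rule genideal_ideal)
  show "\<zero> \<in> Idl F" by (rule I.zero_closed)
  show "x \<oplus> y \<in> Idl F" if "x \<in> Idl F" "y \<in> Idl F" using that by (rule I.a_closed)
  show "r \<otimes> x \<in> Idl F" if "r \<in> carrier R" "x \<in> Idl F" using that I.I_l_closed by blast
  show "x \<in> carrier R" if "x \<in> Idl F" using that by (rule I.a_Hcarr)
qed

lemma (in cring) genideal_induct [consumes 2, case_names gen zero add mult]:
  assumes "F \<subseteq> carrier R" "x \<in> Idl F"
    and "\<And>a. a \<in> F \<Longrightarrow> P a"
    and "P \<zero>"
    and "\<And>x y. x \<in> carrier R \<Longrightarrow> y \<in> carrier R \<Longrightarrow> P x \<Longrightarrow> P y \<Longrightarrow> P (x \<oplus> y)"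
    and "\<And>r x. r \<in> carrier R \<Longrightarrow> x \<in> carrier R \<Longrightarrow> P x \<Longrightarrow> P (r \<otimes> x)"
  shows "P x"
proof -
  have "ideal {x \<in> carrier R. P x} R"
    by (rule ideal_closedI) (use assms in auto)
  then have "Idl F \<subseteq> {x \<in> carrier R. P x}"
    by (rule genideal_minimal) (use assms in auto)
  then show ?thesis using assms(2) by auto
qed

lemma (in cring) PIdl_iff:
  "a \<in> carrier R \<Longrightarrow> x \<in> PIdl a \<longleftrightarrow> (\<exists>y\<in>carrier R. x = a \<otimes> y)"
  unfolding cgenideal_def using m_comm by blast

lemma fin_gen_idealI: "I = Idl\<^bsub>S\<^esub> F \<Longrightarrow> F \<subseteq> carrier S \<Longrightarrow> finite F \<Longrightarrow> fin_gen_ideal S I"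
  unfolding fin_gen_ideal_def by blast

lemma (in cring) PIdl_fin_gen:
  "a \<in> carrier R \<Longrightarrow> fin_gen_ideal R (PIdl a)"
  unfolding fin_gen_ideal_def using cgenideal_eq_genideal
  by (intro exI[of _ "{a}"]) auto

lemma (in cring) nzd_carrier: "non_zero_divisor R c \<Longrightarrow> c \<in> carrier R"
  by (simp add: non_zero_divisor_def)

lemma (in cring) nzdD:
  "non_zero_divisor R c \<Longrightarrow> x \<in> carrier R \<Longrightarrow> c \<otimes> x = \<zero> \<Longrightarrow> x = \<zero>"
  by (simp add: non_zero_divisor_def)

lemma (in cring) nzd_cancel:
  assumes "non_zero_divisor R c" "x \<in> carrier R" "y \<in> carrier R" "c \<otimes> x = c \<otimes> y"
  shows "x = y"
proof -
  have c: "c \<in> carrier R" using assms(1) by (rule nzd_carrier)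
  have "c \<otimes> (x \<ominus> y) = \<zero>"
    using c assms by (simp add: minus_eq r_distr r_minus r_neg)
  then have "x \<ominus> y = \<zero>"
    using assms nzdD by simp
  then show ?thesis using assms by simp
qed

lemma (in cring) nzd_mult:
  assumes "non_zero_divisor R a" "non_zero_divisor R b"
  shows "non_zero_divisor R (a \<otimes> b)"
  unfolding non_zero_divisor_def
proof (intro conjI ballI impI)
  have c: "a \<in> carrier R" "b \<in> carrier R" using assms nzd_carrier by auto
  then show "a \<otimes> b \<in> carrier R" by simp
  fix x assume x: "x \<in> carrier R" "a \<otimes> b \<otimes> x = \<zero>"
  then have "b \<otimes> x = \<zero>" using c nzdD[OF assms(1), of "b \<otimes> x"] by (simp add: m_assoc)
  then show "x = \<zero>" using nzdD[OF assms(2)] x by blast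
qed

lemma (in cring) nzd_factor:
  assumes "non_zero_divisor R (a \<otimes> b)" "a \<in> carrier R" "b \<in> carrier R"
  shows "non_zero_divisor R b"
  unfolding non_zero_divisor_def
proof (intro conjI ballI impI)
  fix x assume x: "x \<in> carrier R" "b \<otimes> x = \<zero>"
  then have "a \<otimes> b \<otimes> x = \<zero>" using assms(2,3) by (simp add: m_assoc)
  then show "x = \<zero>" using nzdD[OF assms(1)] x by blast
qed (rule assms)

text \<open>\<open>p\<close> is the product of the elements of \<open>F\<close> and
  \<open>q a\<close> the product of those other than \<open>a\<close>, so that \<open>q a\<close>
  over \<open>p\<close> is the inverse of \<open>a\<close>. This replaces fractions by elements of
  the ring.\<close>

lemma (in cring) common_multiple:
  assumes "finite F" "\<And>a. a \<in> F \<Longrightarrow> non_zero_divisor R a"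
  shows "\<exists>p q. non_zero_divisor R p \<and> (\<forall>a\<in>F. q a \<in> carrier R \<and> a \<otimes> q a = p)"
  using assms
proof (induction F)
  case empty
  have "non_zero_divisor R \<one>" by (simp add: non_zero_divisor_def)
  then show ?case by auto
next
  case (insert b F)
  then obtain p q where p: "non_zero_divisor R p"
    and q: "\<forall>a\<in>F. q a \<in> carrier R \<and> a \<otimes> q a = p" by auto
  have c: "b \<in> carrier R" "p \<in> carrier R" "a \<in> F \<Longrightarrow> a \<in> carrier R" for a
    using insert.prems p nzd_carrier by auto
  let ?q = "\<lambda>a. if a = b then p else b \<otimes> q a"
  have "non_zero_divisor R (b \<otimes> p)" using insert.prems p nzd_mult by simp
  moreover have "?q a \<in> carrier R \<and> a \<otimes> ?q a = b \<otimes> p" if "a \<in> insert b F" for a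
    using that q c by (auto simp: m_lcomm)
  ultimately show ?case by (intro exI[of _ "b \<otimes> p"] exI[of _ ?q]) simp
qed

section \<open>Rings with projective principal ideals\<close>

text \<open>The annihilator of every element is generated by an idempotent \<open>1 - e\<close>, that is, principal
  ideals are projective.\<close>

definition pp_ring :: "('a, 'b) ring_scheme \<Rightarrow> bool" where
  "pp_ring S \<longleftrightarrow> (\<forall>a\<in>carrier S. \<exists>e\<in>carrier S. e \<otimes>\<^bsub>S\<^esub> a = a \<and>
     (\<forall>x\<in>carrier S. x \<otimes>\<^bsub>S\<^esub> a = \<zero>\<^bsub>S\<^esub> \<longrightarrow> x \<otimes>\<^bsub>S\<^esub> e = \<zero>\<^bsub>S\<^esub>))"

text \<open>Idempotence is automatic: \<open>\<one> \<ominus> e\<close> annihilates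
  \<open>a\<close>, hence also \<open>e\<close>. Such an \<open>e\<close> acts as the support of
  \<open>a\<close>: it fixes \<open>a\<close>, and \<open>a\<close> is cancellable on the ideal
  generated by \<open>e\<close>.\<close>

lemma (in cring) pp_ring_supportE:
  assumes "pp_ring R" "a \<in> carrier R"
  obtains e where "e \<in> carrier R" "e \<otimes> a = a" "e \<otimes> e = e"
    "\<And>x. x \<in> carrier R \<Longrightarrow> x \<otimes> a = \<zero> \<Longrightarrow> x \<otimes> e = \<zero>"
proof -
  obtain e where e: "e \<in> carrier R" "e \<otimes> a = a"
    "\<And>x. x \<in> carrier R \<Longrightarrow> x \<otimes> a = \<zero> \<Longrightarrow> x \<otimes> e = \<zero>"
    using assms unfolding pp_ring_def by blast
  have "(\<one> \<ominus> e) \<otimes> a = \<zero>"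
    using e(1,2) assms(2) by (simp add: minus_eq l_distr l_minus r_neg)
  then have "(\<one> \<ominus> e) \<otimes> e = \<zero>" using e(1) e(3)[of "\<one> \<ominus> e"] by simp
  then have "e \<ominus> e \<otimes> e = \<zero>" using e(1) by (simp add: minus_eq l_distr l_minus)
  then have "e \<otimes> e = e" using e(1) by simp
  with e show thesis using that by blast
qed

text \<open>This settles the annihilator half of quasi-coherence:
  \<open>x \<otimes> e = \<zero>\<close> makes \<open>x\<close> equal to
  \<open>(\<one> \<ominus> e) \<otimes> x\<close>.\<close>

lemma (in cring) pp_ring_annihilator:
  assumes "pp_ring R" "a \<in> carrier R"
  shows "fin_gen_ideal R {x \<in> carrier R. x \<otimes> a = \<zero>}"
proof -
  obtain e where e: "e \<in> carrier R" "e \<otimes> a = a"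
    "\<And>x. x \<in> carrier R \<Longrightarrow> x \<otimes> a = \<zero> \<Longrightarrow> x \<otimes> e = \<zero>"
    using pp_ring_supportE[OF assms] by metis
  have a0: "(\<one> \<ominus> e) \<otimes> a = \<zero>"
    using e(1,2) assms(2) by (simp add: minus_eq l_distr l_minus r_neg)
  have "{x \<in> carrier R. x \<otimes> a = \<zero>} = PIdl (\<one> \<ominus> e)"
  proof (intro equalityI subsetI)
    fix x assume "x \<in> {x \<in> carrier R. x \<otimes> a = \<zero>}"
    then have x: "x \<in> carrier R" "x \<otimes> e = \<zero>" using e(3) by auto
    then have "x = (\<one> \<ominus> e) \<otimes> x"
      using e(1) by (simp add: m_comm[of _ x] minus_eq r_distr r_minus)
    then show "x \<in> PIdl (\<one> \<ominus> e)" using x e(1) by (auto simp: PIdl_iff)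
  next
    fix x assume "x \<in> PIdl (\<one> \<ominus> e)"
    then obtain y where "y \<in> carrier R" "x = y \<otimes> (\<one> \<ominus> e)"
      unfolding cgenideal_def by blast
    then show "x \<in> {x \<in> carrier R. x \<otimes> a = \<zero>}"
      using e(1) assms(2) a0 by (simp add: m_assoc)
  qed
  then show ?thesis using PIdl_fin_gen e(1) by simp
qed

text \<open>The idempotent splits the ring into two factors. The element has component
  \<open>a\<close> on the factor of \<open>e\<close>, where the annihilator hypothesis makes it
  cancellable, and \<open>d\<close> on the factor of \<open>\<one> \<ominus> e\<close>.\<close>

lemma (in cring) idempotent_nzdI:
  assumes "e \<in> carrier R" "a \<in> carrier R" "e \<otimes> e = e"
    and ann: "\<And>x. x \<in> carrier R \<Longrightarrow> x \<otimes> (e \<otimes> a) = \<zero> \<Longrightarrow> x \<otimes> e = \<zero>"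
    and "non_zero_divisor R d"
  shows "non_zero_divisor R (e \<otimes> a \<oplus> d \<otimes> (\<one> \<ominus> e))"
  unfolding non_zero_divisor_def
proof (intro conjI ballI impI)
  have d: "d \<in> carrier R" using assms(5) by (rule nzd_carrier)
  show "e \<otimes> a \<oplus> d \<otimes> (\<one> \<ominus> e) \<in> carrier R" using d assms by simp
  fix x assume x: "x \<in> carrier R" and 0: "(e \<otimes> a \<oplus> d \<otimes> (\<one> \<ominus> e)) \<otimes> x = \<zero>"
  have ee: "(\<one> \<ominus> e) \<otimes> e = \<zero>"
    using assms by (simp add: minus_eq l_distr l_minus r_neg)
  \<comment> \<open>Multiplying by \<open>e\<close> isolates the first component.\<close>
  have "x \<otimes> (e \<otimes> a) = (e \<otimes> a) \<otimes> x \<otimes> e"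
    using x assms(1,2) by (subst assms(3)[symmetric]) (simp add: m_ac)
  also have "\<dots> = (e \<otimes> a \<oplus> d \<otimes> (\<one> \<ominus> e)) \<otimes> x \<otimes> e \<ominus> d \<otimes> ((\<one> \<ominus> e) \<otimes> e) \<otimes> x"
    using x d assms(1,2) by algebra
  also have "\<dots> = \<zero>" unfolding 0 ee using x d assms(1) by simp
  finally have xe: "x \<otimes> e = \<zero>" using ann x by blast
  \<comment> \<open>With \<open>x \<otimes> e\<close> gone, only the component \<open>d\<close> acts
    on \<open>x\<close>.\<close>
  have "d \<otimes> x = (e \<otimes> a \<oplus> d \<otimes> (\<one> \<ominus> e)) \<otimes> x \<ominus> a \<otimes> (x \<otimes> e) \<oplus> d \<otimes> (x \<otimes> e)"
    using x d assms(1,2) by algebra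
  also have "\<dots> = \<zero>" unfolding 0 xe using assms(2) d by simp
  finally show "x = \<zero>" using nzdD[OF assms(5) x] by blast
qed

text \<open>On the support \<open>e\<close> of the new element \<open>b\<close>, \<open>b\<close>
  itself is used, and on the complement the element \<open>d\<close> chosen for the rest. What kills
  \<open>b \<oplus> (\<one> \<ominus> e) \<otimes> d\<close> then kills both summands.\<close>

lemma (in cring) genideal_pick_annihilator:
  assumes pp: "pp_ring R" and "finite F" "F \<subseteq> carrier R"
  shows "\<exists>d\<in>Idl F. \<forall>x\<in>carrier R. x \<otimes> d = \<zero> \<longrightarrow> (\<forall>a\<in>F. x \<otimes> a = \<zero>)"
  using assms(2,3)
proof (induction F)
  case empty
  then show ?case using genideal_closed(1) by blast
next
  case (insert b F)
  have b: "b \<in> carrier R" and F: "F \<subseteq> carrier R" using insert.prems by auto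
  obtain d where d: "d \<in> Idl F"
    and dann: "\<And>x a. x \<in> carrier R \<Longrightarrow> x \<otimes> d = \<zero> \<Longrightarrow> a \<in> F \<Longrightarrow> x \<otimes> a = \<zero>"
    using insert.IH F by blast
  have dc: "d \<in> carrier R" using genideal_closed(4)[OF F d] .
  obtain e where e: "e \<in> carrier R" "e \<otimes> b = b"
    "\<And>x. x \<in> carrier R \<Longrightarrow> x \<otimes> b = \<zero> \<Longrightarrow> x \<otimes> e = \<zero>"
    using pp_ring_supportE[OF pp b] by metis
  let ?d = "b \<oplus> (\<one> \<ominus> e) \<otimes> d"
  have "Idl F \<subseteq> Idl (insert b F)"
    by (rule genideal_minimal)
       (use insert.prems genideal_ideal genideal_self[of "insert b F"] in auto)
  then have "?d \<in> Idl (insert b F)"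
    using insert.prems d e(1) genideal_self[of "insert b F"]
    by (intro genideal_closed(2,3)) auto
  moreover have "x \<otimes> a = \<zero>" if x: "x \<in> carrier R" "x \<otimes> ?d = \<zero>" and a: "a \<in> insert b F" for x a
  proof -
    have "(\<one> \<ominus> e) \<otimes> b = \<zero>"
      using e(1,2) b by (simp add: minus_eq l_distr l_minus r_neg)
    then have "(\<one> \<ominus> e) \<otimes> e = \<zero>" using e(1) e(3)[of "\<one> \<ominus> e"] by simp
    moreover have "x \<otimes> (e \<otimes> b) = e \<otimes> (x \<otimes> ?d) \<ominus> x \<otimes> ((\<one> \<ominus> e) \<otimes> e) \<otimes> d"
      using x(1) e(1) b dc by algebra
    ultimately have xb: "x \<otimes> b = \<zero>"
      using x e(1,2) dc by simp
    then have "x \<otimes> e = \<zero>" using e(3) x(1) by blast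
    moreover have "x \<otimes> d = x \<otimes> ?d \<ominus> x \<otimes> b \<oplus> (x \<otimes> e) \<otimes> d"
      using x(1) e(1) b dc by algebra
    ultimately have "x \<otimes> d = \<zero>" using x(2) xb dc by simp
    then show ?thesis using dann x(1) xb a by auto
  qed
  ultimately show ?case by blast
qed

text \<open>\<open>e\<close> is the product of the supports of the elements of \<open>F\<close>. The
  intersection of their principal ideals lies in the ideal generated by \<open>e\<close>, on which
  each element of \<open>F\<close> is cancellable.\<close>

lemma (in cring) pp_ring_common_support:
  assumes pp: "pp_ring R" and "finite F" "F \<subseteq> carrier R"
  shows "\<exists>e\<in>carrier R. e \<otimes> e = e \<and> (\<forall>x\<in>carrier R. (\<forall>a\<in>F. x \<in> PIdl a) \<longrightarrow> e \<otimes> x = x) \<and>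
    (\<forall>a\<in>F. \<forall>x\<in>carrier R. x \<otimes> a = \<zero> \<longrightarrow> x \<otimes> e = \<zero>)"
  using assms(2,3)
proof (induction F)
  case empty
  then show ?case by (intro bexI[of _ "\<one>"] conjI) auto
next
  case (insert b F)
  have b: "b \<in> carrier R" and F: "F \<subseteq> carrier R" using insert.prems by auto
  obtain e where e: "e \<in> carrier R" "e \<otimes> e = e"
    and ex: "\<And>x. x \<in> carrier R \<Longrightarrow> \<forall>a\<in>F. x \<in> PIdl a \<Longrightarrow> e \<otimes> x = x"
    and ea: "\<And>x a. a \<in> F \<Longrightarrow> x \<in> carrier R \<Longrightarrow> x \<otimes> a = \<zero> \<Longrightarrow> x \<otimes> e = \<zero>"
    using insert.IH F by blast
  obtain f where f: "f \<in> carrier R" "f \<otimes> b = b" "f \<otimes> f = f"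
    and fb: "\<And>x. x \<in> carrier R \<Longrightarrow> x \<otimes> b = \<zero> \<Longrightarrow> x \<otimes> f = \<zero>"
    using pp_ring_supportE[OF pp b] by metis
  show ?case
  proof (intro bexI[of _ "f \<otimes> e"] conjI ballI impI)
    show "f \<otimes> e \<in> carrier R" using e f by simp
    have "f \<otimes> e \<otimes> (f \<otimes> e) = (f \<otimes> f) \<otimes> (e \<otimes> e)" using e(1) f(1) by (simp add: m_ac)
    then show "f \<otimes> e \<otimes> (f \<otimes> e) = f \<otimes> e" using e f by simp
  next
    fix x assume x: "x \<in> carrier R" and xi: "\<forall>a\<in>insert b F. x \<in> PIdl a"
    then obtain y where "y \<in> carrier R" "x = b \<otimes> y" using b PIdl_iff by blast
    then have "f \<otimes> x = x" using b f by (simp add: m_assoc[symmetric])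
    moreover have "e \<otimes> x = x" using x xi ex by blast
    ultimately show "f \<otimes> e \<otimes> x = x" using x e(1) f(1) by (simp add: m_assoc)
  next
    fix a x assume a: "a \<in> insert b F" and x: "x \<in> carrier R" "x \<otimes> a = \<zero>"
    show "x \<otimes> (f \<otimes> e) = \<zero>"
    proof (cases "a = b")
      case True
      then have "x \<otimes> f = \<zero>" using fb x by blast
      then show ?thesis using x(1) e(1) f(1) by (simp add: m_assoc[symmetric])
    next
      case False
      then have "x \<otimes> e = \<zero>" using ea a x by blast
      then show ?thesis using x(1) e(1) f(1) by (simp add: m_lcomm)
    qed
  qed
qed

text \<open>The pp property handles annihilators. An intersection of principal ideals lies in the
  ideal of the common support \<open>e\<close>. Keeping each \<open>a\<close> on that part and
  putting \<open>\<one>\<close> on the complement gives non-zero-divisors, and \<open>e\<close>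
  times generators of the new intersection generate the old one.\<close>

lemma (in cring) pp_ring_quasi_coherentI:
  assumes pp: "pp_ring R"
    and fg: "\<And>F. finite F \<Longrightarrow> F \<noteq> {} \<Longrightarrow> (\<And>a. a \<in> F \<Longrightarrow> non_zero_divisor R a) \<Longrightarrow>
      fin_gen_ideal R (\<Inter>a\<in>F. PIdl a)"
  shows "quasi_coherent R"
  unfolding quasi_coherent_def
proof (intro conjI ballI allI impI)
  show "fin_gen_ideal R {x \<in> carrier R. x \<otimes> a = \<zero>}" if "a \<in> carrier R" for a
    using pp_ring_annihilator[OF pp that] .
  fix F assume F: "F \<subseteq> carrier R" "finite F \<and> F \<noteq> {}"
  obtain e where e: "e \<in> carrier R" "e \<otimes> e = e"
    and ex: "\<And>x. x \<in> carrier R \<Longrightarrow> \<forall>a\<in>F. x \<in> PIdl a \<Longrightarrow> e \<otimes> x = x"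
    and ea: "\<And>x a. a \<in> F \<Longrightarrow> x \<in> carrier R \<Longrightarrow> x \<otimes> a = \<zero> \<Longrightarrow> x \<otimes> e = \<zero>"
    using pp_ring_common_support[OF pp _ F(1)] F(2) by blast
  \<comment> \<open>The factor \<open>\<one>\<close> is the non-zero-divisor \<open>d\<close> of
    \<open>idempotent_nzdI\<close>.\<close>
  define f where "f a = e \<otimes> a \<oplus> \<one> \<otimes> (\<one> \<ominus> e)" for a
  have fc: "f a \<in> carrier R" if "a \<in> F" for a using that F(1) e(1) by (auto simp: f_def)
  have ee: "(\<one> \<ominus> e) \<otimes> e = \<zero>" using e by (simp add: minus_eq l_distr l_minus r_neg)
  have ef: "e \<otimes> f a = e \<otimes> a" if "a \<in> F" for a
  proof -
    have a: "a \<in> carrier R" using that F(1) by auto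
    have "e \<otimes> f a = (e \<otimes> e) \<otimes> a \<oplus> (\<one> \<ominus> e) \<otimes> e"
      unfolding f_def using a e(1) by algebra
    then show ?thesis using ee e a by simp
  qed
  have "non_zero_divisor R (f a)" if a: "a \<in> F" for a
    unfolding f_def
  proof (rule idempotent_nzdI)
    show ac: "a \<in> carrier R" using a F(1) by auto
    fix x assume x: "x \<in> carrier R" "x \<otimes> (e \<otimes> a) = \<zero>"
    then have "x \<otimes> e \<otimes> e = \<zero>" using ea[OF a, of "x \<otimes> e"] e(1) ac by (simp add: m_assoc)
    then show "x \<otimes> e = \<zero>" using x(1) e by (simp add: m_assoc)
  qed (use e in \<open>auto simp: non_zero_divisor_def\<close>)
  then have "fin_gen_ideal R (\<Inter>a\<in>f ` F. PIdl a)"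
    using F by (intro fg) auto
  then obtain G where G: "G \<subseteq> carrier R" "finite G" "(\<Inter>a\<in>F. PIdl (f a)) = Idl G"
    unfolding fin_gen_ideal_def by auto
  let ?G = "(\<otimes>) e ` G"
  have Gc: "?G \<subseteq> carrier R" using G(1) e(1) by auto
  have "(\<Inter>a\<in>F. PIdl a) = Idl ?G"
  proof (intro equalityI subsetI)
    fix x assume "x \<in> (\<Inter>a\<in>F. PIdl a)"
    then have xi: "\<And>a. a \<in> F \<Longrightarrow> x \<in> PIdl a" by auto
    then have xc: "x \<in> carrier R" using F PIdl_iff by (auto simp: subset_iff)
    have xe: "e \<otimes> x = x" using ex xc xi by blast
    have "x \<in> PIdl (f a)" if a: "a \<in> F" for a
    proof -
      obtain y where y: "y \<in> carrier R" "x = a \<otimes> y" using xi[OF a] a F(1) PIdl_iff by blast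
      \<comment> \<open>\<open>a\<close> and \<open>f a\<close> agree after multiplication by
        \<open>e\<close>, and \<open>e\<close> fixes \<open>x\<close>.\<close>
      then have "e \<otimes> x = f a \<otimes> (e \<otimes> y)"
        using ef[OF a] a F(1) e(1) fc[OF a] by (simp add: m_assoc[symmetric] m_comm[of "f a" e] subset_iff)
      then show ?thesis using xe y(1) e(1) fc[OF a] by (auto simp: PIdl_iff)
    qed
    then have "x \<in> Idl G" using G(3) by auto
    with G(1) have "e \<otimes> x \<in> Idl ?G"
    proof (induction rule: genideal_induct)
      case (gen a)
      then show ?case using genideal_self[OF Gc] by blast
    next
      case zero
      then show ?case using genideal_closed(1)[OF Gc] e(1) by simp
    next
      case (add x y)
      then show ?case using genideal_closed(2)[OF Gc] e(1) by (simp add: r_distr)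
    next
      case (mult r x)
      then show ?case using genideal_closed(3)[OF Gc, of r "e \<otimes> x"] e(1) by (simp add: m_lcomm[of e r x])
    qed
    then show "x \<in> Idl ?G" using xe by simp
  next
    have "?G \<subseteq> PIdl a" if a: "a \<in> F" for a
    proof
      fix g assume "g \<in> ?G"
      then obtain h where h: "h \<in> G" "g = e \<otimes> h" by auto
      have "h \<in> PIdl (f a)" using genideal_self[OF G(1)] h(1) G(3) a by blast
      then obtain y where y: "y \<in> carrier R" "h = f a \<otimes> y" using fc[OF a] PIdl_iff by blast
      have "g = a \<otimes> (e \<otimes> y)"
        using h(2) y ef[OF a] a F(1) e(1) fc[OF a] 
        by (simp add: m_assoc[symmetric] m_comm[of a e] subset_iff)
      then show "g \<in> PIdl a" using y(1) e(1) a F(1) by (subst PIdl_iff) auto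
    qed
    then have "Idl ?G \<subseteq> (\<Inter>a\<in>F. PIdl a)"
      using F by (intro INT_greatest genideal_minimal cgenideal_ideal) auto
    then show "x \<in> (\<Inter>a\<in>F. PIdl a)" if "x \<in> Idl ?G" for x using that by blast
  qed
  then show "fin_gen_ideal R (\<Inter>a\<in>F. PIdl a)"
    unfolding fin_gen_ideal_def using Gc G(2) by auto
qed

section \<open>Colon ideals in quasi-coherent rings\<close>

lemma quasi_coherentD:
  "quasi_coherent S \<Longrightarrow> F \<subseteq> carrier S \<Longrightarrow> finite F \<Longrightarrow> F \<noteq> {} \<Longrightarrow>
    fin_gen_ideal S (\<Inter>a\<in>F. PIdl\<^bsub>S\<^esub> a)"
  by (simp add: quasi_coherent_def)

text \<open>This is the colon ideal of \<open>PIdl d\<close> by \<open>U\<close>. As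
  \<open>u \<otimes> q u = p\<close>, the condition on \<open>u \<otimes> z\<close> says that
  \<open>p \<otimes> z\<close> is a multiple of \<open>d \<otimes> q u\<close>. So \<open>p\<close>
  times the colon ideal is an intersection of principal ideals, and dividing its generators by
  \<open>p\<close> gives the generators sought.\<close>

lemma (in cring) quasi_coherent_nzd_quotient:
  assumes qc: "quasi_coherent R" and U: "finite U" "\<And>u. u \<in> U \<Longrightarrow> non_zero_divisor R u"
    and d: "non_zero_divisor R d"
  shows "fin_gen_ideal R {z \<in> carrier R. \<forall>u\<in>U. u \<otimes> z \<in> PIdl d}"
proof -
  obtain p q where p: "non_zero_divisor R p"
    and q: "\<And>u. u \<in> U \<Longrightarrow> q u \<in> carrier R" "\<And>u. u \<in> U \<Longrightarrow> u \<otimes> q u = p"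
    using common_multiple[OF U] by blast
  have c: "d \<in> carrier R" "p \<in> carrier R" "\<And>u. u \<in> U \<Longrightarrow> u \<in> carrier R"
    using d p U(2) nzd_carrier by auto
  let ?W = "{z \<in> carrier R. \<forall>u\<in>U. u \<otimes> z \<in> PIdl d}"
  \<comment> \<open>\<open>p\<close> is added so that the intersection consists of multiples of
    \<open>p\<close>; it also keeps the family non-empty when \<open>U\<close> is empty.\<close>
  let ?P = "insert p ((\<lambda>u. d \<otimes> q u) ` U)"
  have "fin_gen_ideal R (\<Inter>b\<in>?P. PIdl b)"
    by (rule quasi_coherentD[OF qc]) (use U(1) c q(1) in auto)
  then obtain G where G: "G \<subseteq> carrier R" "finite G" "(\<Inter>b\<in>?P. PIdl b) = Idl G"
    unfolding fin_gen_ideal_def by metis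
  \<comment> \<open>\<open>Z\<close> consists of the quotients by \<open>p\<close> of the generators
    in \<open>G\<close>; it is finite because multiplication by \<open>p\<close> is
    injective.\<close>
  define Z where "Z = {z \<in> carrier R. p \<otimes> z \<in> G}"
  have "inj_on (\<lambda>z. p \<otimes> z) (carrier R)" using nzd_cancel[OF p] by (auto intro: inj_onI)
  then have "inj_on (\<lambda>z. p \<otimes> z) Z" unfolding Z_def by (rule inj_on_subset) auto
  moreover have "(\<lambda>z. p \<otimes> z) ` Z \<subseteq> G" by (auto simp: Z_def)
  ultimately have finZ: "finite Z" using G(2) by (meson inj_on_finite)
  have Zc: "Z \<subseteq> carrier R" by (auto simp: Z_def)
  have mem_iff: "z \<in> ?W \<longleftrightarrow> p \<otimes> z \<in> Idl G" if z: "z \<in> carrier R" for z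
  proof -
    have "u \<otimes> z \<in> PIdl d \<longleftrightarrow> p \<otimes> z \<in> PIdl (d \<otimes> q u)" if u: "u \<in> U" for u
    proof -
      have qu: "q u \<in> carrier R" "u \<in> carrier R" using u q c by auto
      \<comment> \<open>As a factor of \<open>p\<close>, \<open>q u\<close> can be cancelled, which
        gives the equivalence.\<close>
      have qn: "non_zero_divisor R (q u)"
        using nzd_factor[of u "q u"] q(2)[OF u] p qu by simp
      have "p \<otimes> z = d \<otimes> q u \<otimes> y \<longleftrightarrow> u \<otimes> z = d \<otimes> y" if y: "y \<in> carrier R" for y
      proof -
        have "p \<otimes> z = q u \<otimes> (u \<otimes> z)"
          unfolding q(2)[OF u, symmetric] using qu z by (simp add: m_ac)
        moreover have "d \<otimes> q u \<otimes> y = q u \<otimes> (d \<otimes> y)" using qu y c by (simp add: m_ac)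
        ultimately show ?thesis using nzd_cancel[OF qn, of "u \<otimes> z" "d \<otimes> y"] qu z y c by auto
      qed
      then show ?thesis using qu c by (simp add: PIdl_iff)
    qed
    moreover have "p \<otimes> z \<in> PIdl p" using c z by (auto simp: PIdl_iff)
    ultimately show ?thesis unfolding G(3)[symmetric] using z by auto
  qed
  have W: "ideal ?W R"
  proof (rule ideal_closedI)
    show "\<zero> \<in> ?W" using mem_iff[of \<zero>] genideal_closed(1)[OF G(1)] c by simp
    show "x \<oplus> y \<in> ?W" if "x \<in> ?W" "y \<in> ?W" for x y
    proof -
      have "x \<in> carrier R" "y \<in> carrier R" using that by auto
      then show ?thesis
        using that genideal_closed(2)[OF G(1)] c
        by (subst mem_iff) (auto simp: r_distr mem_iff simp del: mem_Collect_eq)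
    qed
    show "r \<otimes> x \<in> ?W" if "r \<in> carrier R" "x \<in> ?W" for r x
    proof -
      have "x \<in> carrier R" using that by auto
      then show ?thesis
        using that genideal_closed(3)[OF G(1), of r "p \<otimes> x"] c
        by (subst mem_iff) (auto simp: m_lcomm[of p r x] mem_iff simp del: mem_Collect_eq)
    qed
  qed auto
  have "?W = Idl Z"
  proof
    show "Idl Z \<subseteq> ?W"
    proof (rule genideal_minimal[OF W], rule subsetI)
      fix z assume "z \<in> Z"
      then have "z \<in> carrier R" "p \<otimes> z \<in> Idl G" using genideal_self[OF G(1)] by (auto simp: Z_def)
      then show "z \<in> ?W" using mem_iff by blast
    qed
    show "?W \<subseteq> Idl Z"
    proof
      fix z assume zW: "z \<in> ?W"
      then have z: "z \<in> carrier R" by simp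
      have "p \<otimes> z \<in> Idl G" using mem_iff[OF z] zW by blast
      \<comment> \<open>Every element of the intersection is \<open>p\<close> times an element of
        \<open>Idl Z\<close>; \<open>p\<close> is cancelled afterwards.\<close>
      with G(1) have "\<exists>y\<in>Idl Z. p \<otimes> z = p \<otimes> y"
      proof (induction rule: genideal_induct)
        case (gen g)
        have "g \<in> PIdl p" using genideal_self[OF G(1)] gen G(3) by blast
        then obtain y where "y \<in> carrier R" "g = p \<otimes> y" using c PIdl_iff by blast
        then show ?case using gen genideal_self[OF Zc] by (auto simp: Z_def)
      next
        case zero
        then show ?case using genideal_closed(1)[OF Zc] c by (intro bexI[of _ \<zero>]) auto
      next
        case (add x y)
        then obtain x' y' where "x' \<in> Idl Z" "x = p \<otimes> x'" "y' \<in> Idl Z" "y = p \<otimes> y'" by blast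
        then show ?case using genideal_closed(2,4)[OF Zc] c
          by (intro bexI[of _ "x' \<oplus> y'"]) (auto simp: r_distr)
      next
        case (mult r x)
        then obtain x' where "x' \<in> Idl Z" "x = p \<otimes> x'" by blast
        then show ?case using mult genideal_closed(3,4)[OF Zc] c
          by (intro bexI[of _ "r \<otimes> x'"]) (auto simp: m_lcomm[of p r x'])
      qed
      then show "z \<in> Idl Z" using nzd_cancel[OF p z] genideal_closed(4)[OF Zc] by metis
    qed
  qed
  then show ?thesis unfolding fin_gen_ideal_def using Zc finZ by blast
qed

text \<open>Elements of \<open>U\<close> may be zero divisors here. Adding \<open>d\<close> on the
  complement of the support of \<open>u\<close> makes it a non-zero-divisor and changes it only by a
  multiple of \<open>d\<close>, which the condition modulo \<open>d\<close> does not see.\<close>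

lemma (in cring) pp_ring_quasi_coherent_quotient:
  assumes pp: "pp_ring R" and qc: "quasi_coherent R" and U: "finite U" "U \<subseteq> carrier R"
    and d: "non_zero_divisor R d"
  shows "fin_gen_ideal R {z \<in> carrier R. \<forall>u\<in>U. u \<otimes> z \<in> PIdl d}"
proof -
  have dc: "d \<in> carrier R" using d nzd_carrier by blast
  have "\<forall>u\<in>U. \<exists>e. e \<in> carrier R \<and> e \<otimes> u = u \<and> e \<otimes> e = e \<and>
      (\<forall>x\<in>carrier R. x \<otimes> u = \<zero> \<longrightarrow> x \<otimes> e = \<zero>)"
  proof
    fix u assume "u \<in> U"
    then have "u \<in> carrier R" using U(2) by blast
    from pp_ring_supportE[OF pp this] show "\<exists>e. e \<in> carrier R \<and> e \<otimes> u = u \<and> e \<otimes> e = e \<and>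
      (\<forall>x\<in>carrier R. x \<otimes> u = \<zero> \<longrightarrow> x \<otimes> e = \<zero>)" by metis
  qed
  from bchoice[OF this] obtain e where "\<forall>u\<in>U. e u \<in> carrier R \<and> e u \<otimes> u = u \<and> e u \<otimes> e u = e u \<and>
      (\<forall>x\<in>carrier R. x \<otimes> u = \<zero> \<longrightarrow> x \<otimes> e u = \<zero>)" ..
  then have e: "\<And>u. u \<in> U \<Longrightarrow> e u \<in> carrier R" "\<And>u. u \<in> U \<Longrightarrow> e u \<otimes> u = u"
    "\<And>u. u \<in> U \<Longrightarrow> e u \<otimes> e u = e u"
    "\<And>u x. u \<in> U \<Longrightarrow> x \<in> carrier R \<Longrightarrow> x \<otimes> u = \<zero> \<Longrightarrow> x \<otimes> e u = \<zero>"
    by blast+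
  define f where "f u = e u \<otimes> u \<oplus> d \<otimes> (\<one> \<ominus> e u)" for u
  have "non_zero_divisor R (f u)" if "u \<in> U" for u
    unfolding f_def by (rule idempotent_nzdI) (use that e U(2) d in auto)
  then have fg: "fin_gen_ideal R {z \<in> carrier R. \<forall>u\<in>f ` U. u \<otimes> z \<in> PIdl d}"
    using U(1) d by (intro quasi_coherent_nzd_quotient[OF qc]) auto
  have "f u \<otimes> z \<in> PIdl d \<longleftrightarrow> u \<otimes> z \<in> PIdl d" if u: "u \<in> U" and z: "z \<in> carrier R" for u z
  proof -
    interpret D: ideal "PIdl d" R using dc by (rule cgenideal_ideal)
    have uc: "u \<in> carrier R" "e u \<in> carrier R" using u U(2) e(1) by auto
    let ?s = "d \<otimes> ((\<one> \<ominus> e u) \<otimes> z)"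
    have s: "?s \<in> PIdl d" using dc uc z by (subst PIdl_iff) auto
    have eq: "f u \<otimes> z = u \<otimes> z \<oplus> ?s" unfolding f_def e(2)[OF u] using dc uc z by algebra
    then have eq': "u \<otimes> z = f u \<otimes> z \<oplus> (\<ominus> ?s)" using dc uc z by (simp add: a_assoc r_neg)
    show ?thesis using eq eq' s D.a_closed D.a_inv_closed by metis
  qed
  then have "{z \<in> carrier R. \<forall>u\<in>f ` U. u \<otimes> z \<in> PIdl d} = {z \<in> carrier R. \<forall>u\<in>U. u \<otimes> z \<in> PIdl d}"
    by auto
  then show ?thesis using fg by simp
qed

section \<open>Finite products of domains\<close>

lemma pp_ring_domain:
  assumes "domain D" shows "pp_ring D"
  unfolding pp_ring_def
proof
  interpret domain D by fact
  show "\<exists>e\<in>carrier D. e \<otimes>\<^bsub>D\<^esub> a = a \<and>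
      (\<forall>x\<in>carrier D. x \<otimes>\<^bsub>D\<^esub> a = \<zero>\<^bsub>D\<^esub> \<longrightarrow> x \<otimes>\<^bsub>D\<^esub> e = \<zero>\<^bsub>D\<^esub>)" if "a \<in> carrier D" for a
  proof (cases "a = \<zero>\<^bsub>D\<^esub>")
    case True
    then show ?thesis by (intro bexI[of _ "\<zero>\<^bsub>D\<^esub>"]) auto
  next
    case False
    then show ?thesis using that by (intro bexI[of _ "\<one>\<^bsub>D\<^esub>"]) (auto simp: integral_iff)
  qed
qed

lemma pp_ring_RDirProd:
  assumes "pp_ring D" "pp_ring E" shows "pp_ring (RDirProd D E)"
  unfolding pp_ring_def
proof
  fix a assume "a \<in> carrier (RDirProd D E)"
  then obtain b c where a: "a = (b, c)" "b \<in> carrier D" "c \<in> carrier E"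
    by (auto simp: RDirProd_carrier)
  obtain e where e: "e \<in> carrier D" "e \<otimes>\<^bsub>D\<^esub> b = b"
    "\<And>x. x \<in> carrier D \<Longrightarrow> x \<otimes>\<^bsub>D\<^esub> b = \<zero>\<^bsub>D\<^esub> \<Longrightarrow> x \<otimes>\<^bsub>D\<^esub> e = \<zero>\<^bsub>D\<^esub>"
    using assms(1) a(2) unfolding pp_ring_def by blast
  obtain f where f: "f \<in> carrier E" "f \<otimes>\<^bsub>E\<^esub> c = c"
    "\<And>x. x \<in> carrier E \<Longrightarrow> x \<otimes>\<^bsub>E\<^esub> c = \<zero>\<^bsub>E\<^esub> \<Longrightarrow> x \<otimes>\<^bsub>E\<^esub> f = \<zero>\<^bsub>E\<^esub>"
    using assms(2) a(3) unfolding pp_ring_def by blast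
  show "\<exists>e\<in>carrier (RDirProd D E). e \<otimes>\<^bsub>RDirProd D E\<^esub> a = a \<and>
      (\<forall>x\<in>carrier (RDirProd D E). x \<otimes>\<^bsub>RDirProd D E\<^esub> a = \<zero>\<^bsub>RDirProd D E\<^esub> \<longrightarrow>
         x \<otimes>\<^bsub>RDirProd D E\<^esub> e = \<zero>\<^bsub>RDirProd D E\<^esub>)"
    by (rule bexI[of _ "(e, f)"])
       (use a e f in \<open>auto simp: RDirProd_def DirProd_def monoid.defs\<close>)
qed

lemma pp_ring_iso:
  assumes "ring D" "ring E" "D \<simeq> E" "pp_ring E" shows "pp_ring D"
proof -
  obtain h where h: "h \<in> ring_iso D E" using assms(3) by (auto simp: is_ring_iso_def)
  interpret D: ring D by fact
  interpret E: ring E by fact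
  interpret h: ring_hom_ring D E h
    by (rule ring_hom_ringI2) (use h assms ring_iso_def in auto)
  have bij: "bij_betw h (carrier D) (carrier E)" using h by (auto simp: ring_iso_def)
  then have inj: "x = y" if "h x = h y" "x \<in> carrier D" "y \<in> carrier D" for x y
    using that by (auto simp: bij_betw_def inj_on_def)
  show ?thesis
    unfolding pp_ring_def
  proof
    fix a assume a: "a \<in> carrier D"
    then obtain e' where e': "e' \<in> carrier E" "e' \<otimes>\<^bsub>E\<^esub> h a = h a"
      "\<And>x. x \<in> carrier E \<Longrightarrow> x \<otimes>\<^bsub>E\<^esub> h a = \<zero>\<^bsub>E\<^esub> \<Longrightarrow> x \<otimes>\<^bsub>E\<^esub> e' = \<zero>\<^bsub>E\<^esub>"
      using assms(4) h.hom_closed unfolding pp_ring_def by blast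
    obtain e where e: "e \<in> carrier D" "h e = e'"
      using bij e'(1) unfolding bij_betw_def by (metis imageE)
    show "\<exists>e\<in>carrier D. e \<otimes>\<^bsub>D\<^esub> a = a \<and>
        (\<forall>x\<in>carrier D. x \<otimes>\<^bsub>D\<^esub> a = \<zero>\<^bsub>D\<^esub> \<longrightarrow> x \<otimes>\<^bsub>D\<^esub> e = \<zero>\<^bsub>D\<^esub>)"
    proof (intro bexI[of _ e] conjI ballI impI)
      show "e \<otimes>\<^bsub>D\<^esub> a = a" using inj a e e' by simp
      fix x assume x: "x \<in> carrier D" "x \<otimes>\<^bsub>D\<^esub> a = \<zero>\<^bsub>D\<^esub>"
      then have "h x \<otimes>\<^bsub>E\<^esub> h a = \<zero>\<^bsub>E\<^esub>" using a by (metis h.hom_mult h.hom_zero)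
      then have "h (x \<otimes>\<^bsub>D\<^esub> e) = h \<zero>\<^bsub>D\<^esub>" using x e e'(3)[of "h x"] by simp
      then show "x \<otimes>\<^bsub>D\<^esub> e = \<zero>\<^bsub>D\<^esub>" using inj x e by simp
    qed (rule e)
  qed
qed

text \<open>That the product is a ring is part of the induction, since the transport along the
  isomorphism of \<open>RDirProd_list (D # Ds)\<close> with a binary product needs it. The empty
  product is the zero ring.\<close>

lemma pp_ring_RDirProd_list:
  assumes "\<And>D. D \<in> set Ds \<Longrightarrow> domain D"
  shows "ring (RDirProd_list Ds) \<and> pp_ring (RDirProd_list Ds)"
  using assms
proof (induction Ds)
  case Nil
  have "ring (RDirProd_list ([] :: ('a, 'b) ring_scheme list))" by (rule RDirProd_list_is_ring) simp
  then show ?case by (simp add: pp_ring_def monoid.defs)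
next
  case (Cons D Ds)
  have D: "domain D" and rD: "ring D" using Cons.prems domain.axioms(1) cring.axioms(1) by auto
  have IH: "ring (RDirProd_list Ds)" "pp_ring (RDirProd_list Ds)" using Cons by auto
  have r: "ring (RDirProd D (RDirProd_list Ds))" using rD IH(1) by (rule RDirProd_ring)
  have "ring E" if "E \<in> set (D # Ds)" for E
    using Cons.prems that domain.axioms(1) cring.axioms(1) by blast
  then have r': "ring (RDirProd_list (D # Ds))"
    by (intro RDirProd_list_is_ring) (metis nth_mem)
  have "RDirProd_list (D # Ds) \<simeq> RDirProd D (RDirProd_list Ds)"
    using RDirProd_list_iso2 is_ring_iso_def by blast
  then have "pp_ring (RDirProd_list (D # Ds))"
    using pp_ring_iso[OF r' r] pp_ring_RDirProd[OF pp_ring_domain[OF D] IH(2)] by blast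
  then show ?case using r' by blast
qed

section \<open>Families generating the unit ideal\<close>

text \<open>The elements \<open>t\<close> with \<open>t \<otimes> x\<close> in \<open>K\<close> form
  an ideal; containing \<open>U\<close>, it contains \<open>\<one>\<close>.\<close>

lemma (in cring) unimodular_cancel:
  assumes K: "ideal K R" and u: "U \<subseteq> carrier R" "Idl U = carrier R"
    and x: "x \<in> carrier R" "\<And>u. u \<in> U \<Longrightarrow> u \<otimes> x \<in> K"
  shows "x \<in> K"
proof -
  interpret K: ideal K R by (rule K)
  have "\<one> \<in> Idl U" using u(2) by simp
  with u(1) have "\<one> \<otimes> x \<in> K"
  proof (induction rule: genideal_induct)
    case (gen a) then show ?case by (rule x(2))
  next
    case zero then show ?case using x(1) K.zero_closed by simp
  next
    case (add y z) then show ?case using x(1) K.a_closed by (simp add: l_distr)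
  next
    case (mult r y) then show ?case using x(1) K.I_l_closed by (simp add: m_assoc)
  qed
  then show ?thesis using x(1) by simp
qed

text \<open>The \<open>t\<close> such that the family \<open>t v a\<close> is a multiple of the family \<open>u a\<close> modulo \<open>K\<close> form
  an ideal containing every \<open>u a\<close>.\<close>

lemma (in cring) unimodular_patching:
  assumes K: "ideal K R" and u: "u ` F \<subseteq> carrier R" "Idl (u ` F) = carrier R"
    and v: "\<And>a. a \<in> F \<Longrightarrow> v a \<in> carrier R"
    and uv: "\<And>a b. a \<in> F \<Longrightarrow> b \<in> F \<Longrightarrow> v a \<otimes> u b \<ominus> v b \<otimes> u a \<in> K"
  shows "\<exists>y\<in>carrier R. \<forall>a\<in>F. y \<otimes> u a \<ominus> v a \<in> K"
proof -
  interpret K: ideal K R by (rule K)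
  have uc: "u a \<in> carrier R" if "a \<in> F" for a using u(1) that by auto
  have "\<one> \<in> Idl (u ` F)" using u(2) by simp
  with u(1) have "\<exists>y\<in>carrier R. \<forall>a\<in>F. y \<otimes> u a \<ominus> \<one> \<otimes> v a \<in> K"
  proof (induction rule: genideal_induct)
    case (gen t)
    then obtain a where a: "a \<in> F" "t = u a" by auto
    \<comment> \<open>The witness for \<open>t = u a\<close> is \<open>v a\<close>, by the cross
      relation.\<close>
    have "v a \<otimes> u b \<ominus> t \<otimes> v b \<in> K" if "b \<in> F" for b
      using uv[OF a(1) that] uc v a that by (simp add: m_comm)
    then show ?case using v a(1) by blast
  next
    case zero
    have "\<zero> \<otimes> u a \<ominus> \<zero> \<otimes> v a \<in> K" if "a \<in> F" for a
      using uc v that K.zero_closed by (simp add: a_minus_def)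
    then show ?case by blast
  next
    case (add s t)
    obtain y where y: "y \<in> carrier R" "\<And>a. a \<in> F \<Longrightarrow> y \<otimes> u a \<ominus> s \<otimes> v a \<in> K"
      using add.IH by blast
    obtain z where z: "z \<in> carrier R" "\<And>a. a \<in> F \<Longrightarrow> z \<otimes> u a \<ominus> t \<otimes> v a \<in> K"
      using add.IH by blast
    have "(y \<oplus> z) \<otimes> u a \<ominus> (s \<oplus> t) \<otimes> v a \<in> K" if a: "a \<in> F" for a
    proof -
      have "(y \<oplus> z) \<otimes> u a \<ominus> (s \<oplus> t) \<otimes> v a =
          (y \<otimes> u a \<ominus> s \<otimes> v a) \<oplus> (z \<otimes> u a \<ominus> t \<otimes> v a)"
        using y(1) z(1) uc[OF a] v[OF a] add.hyps by algebra
      then show ?thesis using K.a_closed[OF y(2)[OF a] z(2)[OF a]] by simp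
    qed
    then show ?case using y(1) z(1) by blast
  next
    case (mult r t)
    obtain y where y: "y \<in> carrier R" "\<And>a. a \<in> F \<Longrightarrow> y \<otimes> u a \<ominus> t \<otimes> v a \<in> K"
      using mult.IH by blast
    have "(r \<otimes> y) \<otimes> u a \<ominus> (r \<otimes> t) \<otimes> v a \<in> K" if a: "a \<in> F" for a
    proof -
      have "(r \<otimes> y) \<otimes> u a \<ominus> (r \<otimes> t) \<otimes> v a = r \<otimes> (y \<otimes> u a \<ominus> t \<otimes> v a)"
        using y(1) uc[OF a] v[OF a] mult.hyps by algebra
      then show ?thesis using K.I_l_closed[OF y(2)[OF a] mult.hyps(1)] by simp
    qed
    then show ?case using y(1) mult.hyps(1) by blast
  qed
  then show ?thesis using v by (simp cong: ball_cong)
qed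

lemma (in cring) PIdl_Inter_quotients:
  assumes "F \<subseteq> carrier R" "\<And>a. a \<in> F \<Longrightarrow> x \<in> PIdl a"
  shows "\<exists>v. \<forall>a\<in>F. v a \<in> carrier R \<and> x = a \<otimes> v a"
proof (rule bchoice, rule ballI)
  fix a assume a: "a \<in> F"
  then have "a \<in> carrier R" using assms(1) by blast
  then show "\<exists>v. v \<in> carrier R \<and> x = a \<otimes> v" using assms(2)[OF a] PIdl_iff by blast
qed

lemma (in "domain") nzd_iff: "non_zero_divisor R a \<longleftrightarrow> a \<in> carrier R - {\<zero>}"
proof
  assume a: "non_zero_divisor R a"
  then have "a \<noteq> \<zero>" using nzdD[OF a, of \<one>] by auto
  then show "a \<in> carrier R - {\<zero>}" using nzd_carrier[OF a] by simp
next
  assume "a \<in> carrier R - {\<zero>}"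
  then show "non_zero_divisor R a" using integral by (auto simp: non_zero_divisor_def)
qed

section \<open>Conductor squares of domains\<close>

text \<open>All that is used of the condition on finitely generated ideals: the fractional ideal
  generated by the inverses of the elements of \<open>F\<close> is \<open>1 / w\<close> times the ideal generated by the
  \<open>u a\<close>, and the latter extends to the unit ideal of \<open>T\<close>.\<close>

locale domain_conductor_square = conductor_square T R C + "domain" T
  for T (structure) and R C +
  assumes unimodular_multiple:
    "\<And>F. finite F \<Longrightarrow> F \<noteq> {} \<Longrightarrow> F \<subseteq> carrier T - {\<zero>} \<Longrightarrow>
      \<exists>u w. (\<forall>a\<in>F. u a \<in> carrier R \<and> a \<otimes> u a = w) \<and> Idl (u ` F) = carrier T"

text \<open>Equations between the operations themselves can serve as \<open>rewrites\<close> in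
  interpretations, so that facts about \<open>R\<close> are stated with the operations of
  \<open>T\<close>.\<close>

lemma (in conductor_square) sub_simps:
  shows "(\<otimes>\<^bsub>R\<^esub>) = (\<otimes>\<^bsub>T\<^esub>)" "(\<oplus>\<^bsub>R\<^esub>) = (\<oplus>\<^bsub>T\<^esub>)" "\<one>\<^bsub>R\<^esub> = \<one>\<^bsub>T\<^esub>" "\<zero>\<^bsub>R\<^esub> = \<zero>\<^bsub>T\<^esub>"
  by (subst sub_ops, simp)+

lemma (in conductor_square) sub_cring: "cring R"
proof -
  interpret cring T by (rule cring_T)
  have "cring (T\<lparr>carrier := carrier R\<rparr>)"
    using subcring_iff[OF subringE(1)[OF sub_carrier]] subcringI'[OF sub_carrier] by blast
  then show ?thesis using sub_ops by simp
qed

text \<open>Negation is not a field of the record but is computed inside the carrier, so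
  \<open>sub_simps\<close> does not cover it; uniqueness of additive inverses in \<open>T\<close>
  does.\<close>

lemma (in conductor_square) sub_minus:
  assumes "x \<in> carrier R" "y \<in> carrier R"
  shows "x \<ominus>\<^bsub>R\<^esub> y = x \<ominus>\<^bsub>T\<^esub> y"
proof -
  interpret T: cring T by (rule cring_T)
  interpret R: cring R by (rule sub_cring)
  have "y \<in> carrier T" using assms subringE(1)[OF sub_carrier] by auto
  moreover have "\<ominus>\<^bsub>R\<^esub> y \<in> carrier T" using assms subringE(1)[OF sub_carrier] by auto
  moreover have "\<ominus>\<^bsub>R\<^esub> y \<oplus>\<^bsub>T\<^esub> y = \<zero>\<^bsub>T\<^esub>" using R.l_neg[OF assms(2)] by (simp add: sub_simps)
  ultimately have "\<ominus>\<^bsub>T\<^esub> y = \<ominus>\<^bsub>R\<^esub> y" using T.minus_equality by blast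
  then show ?thesis by (simp add: a_minus_def sub_simps)
qed

context domain_conductor_square
begin

lemma sub_domain: "domain R"
  using subring_is_domain[OF sub_carrier] sub_ops by simp

sublocale R: "domain" R
  rewrites "(\<otimes>\<^bsub>R\<^esub>) = (\<otimes>\<^bsub>T\<^esub>)" and "(\<oplus>\<^bsub>R\<^esub>) = (\<oplus>\<^bsub>T\<^esub>)"
    and "\<one>\<^bsub>R\<^esub> = \<one>\<^bsub>T\<^esub>" and "\<zero>\<^bsub>R\<^esub> = \<zero>\<^bsub>T\<^esub>"
  by (simp_all add: sub_domain sub_simps)

lemma sub_closed: "x \<in> carrier R \<Longrightarrow> x \<in> carrier T"
  using subringE(1)[OF sub_carrier] by blast

sublocale CT: ideal C T by (rule ideal_T)
sublocale CR: ideal C R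
  rewrites "(\<otimes>\<^bsub>R\<^esub>) = (\<otimes>\<^bsub>T\<^esub>)" and "(\<oplus>\<^bsub>R\<^esub>) = (\<oplus>\<^bsub>T\<^esub>)"
    and "\<one>\<^bsub>R\<^esub> = \<one>\<^bsub>T\<^esub>" and "\<zero>\<^bsub>R\<^esub> = \<zero>\<^bsub>T\<^esub>"
  by (simp_all add: ideal_R sub_simps)

section \<open>The projection of \<open>R\<close> onto \<open>A\<close>\<close>

abbreviation A where "A \<equiv> R Quot C"
abbreviation \<eta> where "\<eta> x \<equiv> C +>\<^bsub>R\<^esub> x"

sublocale A: cring A
  using CR.quotient_is_cring[OF sub_cring] .

lemma \<eta>_hom: "ring_hom_ring R A (\<lambda>x. \<eta> x)"
  using ideal.rcos_ring_hom_ring[OF ideal_R] by simp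

lemma \<eta>_closed [simp]: "x \<in> carrier R \<Longrightarrow> \<eta> x \<in> carrier A"
  using ring_hom_ring.homh[OF \<eta>_hom] ring_hom_closed by fastforce

lemma \<eta>_mult: "x \<in> carrier R \<Longrightarrow> y \<in> carrier R \<Longrightarrow> \<eta> (x \<otimes> y) = \<eta> x \<otimes>\<^bsub>A\<^esub> \<eta> y"
  using ring_hom_mult[OF ring_hom_ring.homh[OF \<eta>_hom]] by (simp add: sub_simps)

lemma \<eta>_add: "x \<in> carrier R \<Longrightarrow> y \<in> carrier R \<Longrightarrow> \<eta> (x \<oplus> y) = \<eta> x \<oplus>\<^bsub>A\<^esub> \<eta> y"
  using ring_hom_add[OF ring_hom_ring.homh[OF \<eta>_hom]] by (simp add: sub_simps)

lemma \<eta>_eq_iff: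
  "x \<in> carrier R \<Longrightarrow> y \<in> carrier R \<Longrightarrow> \<eta> x = \<eta> y \<longleftrightarrow> x \<ominus> y \<in> C"
  using ring.quotient_eq_iff_same_a_r_cos[OF R.ring_axioms ideal_R] by (simp add: sub_minus)

text \<open>This is the pullback property of the square: \<open>C\<close> is contained in
  \<open>R\<close>, so an element of \<open>T\<close> whose class modulo \<open>C\<close> comes from
  \<open>R\<close> lies in \<open>R\<close>.\<close>

lemma \<eta>_congruent:
  assumes "x \<in> carrier T" "y \<in> carrier R" "x \<ominus> y \<in> C"
  shows "x \<in> carrier R \<and> \<eta> x = \<eta> y"
proof -
  have "x = (x \<ominus> y) \<oplus> y"
    using assms(1,2) sub_closed by (simp add: a_minus_def a_assoc l_neg)
  then have "x \<in> carrier R"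
    using R.a_closed[OF CR.Icarr[OF assms(3)] assms(2)] by simp
  then show ?thesis using \<eta>_eq_iff assms(2,3) by blast
qed

lemma \<eta>_zero: "\<eta> \<zero> = \<zero>\<^bsub>A\<^esub>"
proof -
  have "\<eta> \<zero>\<^bsub>R\<^esub> = \<zero>\<^bsub>A\<^esub>"
    using ring_hom_zero[OF ring_hom_ring.homh[OF \<eta>_hom]] sub_cring A.ring_axioms cring.axioms(1)
    by blast
  then show ?thesis by (simp add: sub_simps)
qed

lemma \<eta>_zero_iff: "x \<in> carrier R \<Longrightarrow> \<eta> x = \<zero>\<^bsub>A\<^esub> \<longleftrightarrow> x \<in> C"
  using \<eta>_eq_iff[of x \<zero>] sub_closed by (simp add: \<eta>_zero[symmetric] a_minus_def)

lemma \<eta>_surjE: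
  assumes "z \<in> carrier A" obtains x where "x \<in> carrier R" "\<eta> x = z"
  using assms unfolding FactRing_def A_RCOSETS_defs a_r_coset_def by auto

lemma \<eta>_genideal:
  assumes "G \<subseteq> carrier R" "x \<in> Idl\<^bsub>R\<^esub> G" shows "\<eta> x \<in> Idl\<^bsub>A\<^esub> ((\<lambda>x. \<eta> x) ` G)"
proof -
  have G: "(\<lambda>x. \<eta> x) ` G \<subseteq> carrier A" using assms(1) by auto
  show ?thesis using assms
  proof (induction rule: R.genideal_induct)
    case (gen a)
    then show ?case using A.genideal_self[OF G] by blast
  qed (use A.genideal_closed[OF G] in \<open>auto simp: \<eta>_zero \<eta>_add \<eta>_mult\<close>)
qed

text \<open>Scalars from \<open>A\<close> lift because \<open>\<eta>\<close> is surjective, so the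
  lift can be chosen inside the ideal generated by \<open>G\<close> and not just in
  \<open>R\<close>.\<close>

lemma \<eta>_genideal_lift:
  assumes "G \<subseteq> carrier R" "z \<in> Idl\<^bsub>A\<^esub> ((\<lambda>x. \<eta> x) ` G)"
  shows "\<exists>x\<in>Idl\<^bsub>R\<^esub> G. \<eta> x = z"
proof -
  note cl = R.genideal_closed[OF assms(1)]
  have G: "(\<lambda>x. \<eta> x) ` G \<subseteq> carrier A" using assms(1) by auto
  from G assms(2) show ?thesis
  proof (induction rule: A.genideal_induct)
    case (gen a)
    then show ?case using R.genideal_self[OF assms(1)] by blast
  next
    case zero
    then show ?case using cl(1) \<eta>_zero by blast
  next
    case (add x y)
    then obtain x' y' where "x' \<in> Idl\<^bsub>R\<^esub> G" "\<eta> x' = x" "y' \<in> Idl\<^bsub>R\<^esub> G" "\<eta> y' = y" by blast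
    then show ?case using cl(2,4) by (intro bexI[of _ "x' \<oplus> y'"]) (auto simp: \<eta>_add)
  next
    case (mult r x)
    then obtain x' where "x' \<in> Idl\<^bsub>R\<^esub> G" "\<eta> x' = x" by blast
    moreover obtain r' where "r' \<in> carrier R" "\<eta> r' = r" using mult(1) by (rule \<eta>_surjE)
    ultimately show ?case using cl(3,4) by (intro bexI[of _ "r' \<otimes> x'"]) (auto simp: \<eta>_mult)
  qed
qed

text \<open>The fractions \<open>v a / u a\<close> all equal \<open>x / w\<close>. Cross-multiplied,
  they satisfy the hypothesis of \<open>unimodular_patching\<close> for the zero ideal, which shows
  that the common value lies in \<open>T\<close>.\<close>

lemma common_quotient:
  assumes F: "F \<noteq> {}" "F \<subseteq> carrier T - {\<zero>}"
    and u: "\<And>a. a \<in> F \<Longrightarrow> u a \<in> carrier T" "\<And>a. a \<in> F \<Longrightarrow> a \<otimes> u a = w"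
      "Idl (u ` F) = carrier T"
    and v: "\<And>a. a \<in> F \<Longrightarrow> v a \<in> carrier T" "\<And>a. a \<in> F \<Longrightarrow> x = a \<otimes> v a"
  shows "\<exists>y\<in>carrier T. x = w \<otimes> y \<and> (\<forall>a\<in>F. y \<otimes> u a = v a)"
proof -
  have "v a \<otimes> u b \<ominus> v b \<otimes> u a \<in> {\<zero>}" if a: "a \<in> F" and b: "b \<in> F" for a b
  proof -
    have c: "a \<in> carrier T" "b \<in> carrier T" using a b F by auto
    \<comment> \<open>Both sides become \<open>x \<otimes> w\<close> after multiplication by
      \<open>a \<otimes> b\<close>.\<close>
    have "(a \<otimes> b) \<otimes> (v a \<otimes> u b) = (a \<otimes> v a) \<otimes> (b \<otimes> u b)"
      using c u(1) v(1) a b by (simp add: m_ac)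
    also have "\<dots> = (b \<otimes> v b) \<otimes> (a \<otimes> u a)"
      using u(2) v(2) a b by metis
    also have "\<dots> = (a \<otimes> b) \<otimes> (v b \<otimes> u a)"
      using c u(1) v(1) a b by (simp add: m_ac)
    finally have eq: "(a \<otimes> b) \<otimes> (v a \<otimes> u b) = (a \<otimes> b) \<otimes> (v b \<otimes> u a)" .
    have "a \<noteq> \<zero>" "b \<noteq> \<zero>" using F a b by auto
    then have "a \<otimes> b \<noteq> \<zero>" using c integral by blast
    then have "v a \<otimes> u b = v b \<otimes> u a" using m_lcancel[of "a \<otimes> b"] eq c u(1) v(1) a b by simp
    then show ?thesis using c u(1) v(1) a b by simp
  qed
  then obtain y where y: "y \<in> carrier T" "\<And>a. a \<in> F \<Longrightarrow> y \<otimes> u a \<ominus> v a \<in> {\<zero>}"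
    using unimodular_patching[OF zeroideal _ u(3), of v] u(1) v(1) by blast
  then have yu: "y \<otimes> u a = v a" if "a \<in> F" for a
    using that y(2)[OF that] y(1) u(1) v(1) by simp
  obtain a where a: "a \<in> F" using F by blast
  then have "a \<in> carrier T" using F by auto
  then have "x = w \<otimes> y"
    using v(2)[OF a] yu[OF a, symmetric] u(1,2)[OF a] y(1) by (metis m_assoc m_comm)
  then show ?thesis using y(1) yu by blast
qed

text \<open>\<open>w\<close> is a least common multiple of the elements of \<open>F\<close>:
  \<open>common_quotient\<close> divides every common multiple by it.\<close>

lemma quasi_coherent_T: "quasi_coherent T"
proof (rule pp_ring_quasi_coherentI)
  show "pp_ring T" by (rule pp_ring_domain) (rule domain_axioms)
  fix F assume F: "finite F" "F \<noteq> {}" "\<And>a. a \<in> F \<Longrightarrow> non_zero_divisor T a"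
  then have F0: "F \<subseteq> carrier T - {\<zero>}" using nzd_iff by blast
  obtain u w where u: "\<And>a. a \<in> F \<Longrightarrow> u a \<in> carrier T" "\<And>a. a \<in> F \<Longrightarrow> a \<otimes> u a = w"
    "Idl (u ` F) = carrier T"
    using unimodular_multiple[OF F(1,2) F0] sub_closed by metis
  obtain a0 where a0: "a0 \<in> F" using F by blast
  have w: "w \<in> carrier T" using u(1,2)[OF a0] F0 a0 by blast
  have "(\<Inter>a\<in>F. PIdl a) = PIdl w"
  proof (intro equalityI subsetI)
    fix x assume "x \<in> (\<Inter>a\<in>F. PIdl a)"
    then obtain v where "\<And>a. a \<in> F \<Longrightarrow> v a \<in> carrier T \<and> x = a \<otimes> v a"
      using PIdl_Inter_quotients[of F x] F0 by blast
    then have "\<exists>y\<in>carrier T. x = w \<otimes> y"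
      using common_quotient[OF F(2) F0 u, of v x] by blast
    then show "x \<in> PIdl w" using w PIdl_iff by blast
  next
    fix x assume "x \<in> PIdl w"
    then obtain y where y: "y \<in> carrier T" "x = w \<otimes> y" using w PIdl_iff by blast
    have "x \<in> PIdl a" if a: "a \<in> F" for a
    proof -
      have "a \<in> carrier T" using F0 a by auto
      moreover have "x = a \<otimes> (u a \<otimes> y)"
        using u(1)[OF a] u(2)[OF a, symmetric] y calculation by (simp add: m_assoc)
      ultimately show ?thesis using PIdl_iff u(1)[OF a] y(1) by blast
    qed
    then show "x \<in> (\<Inter>a\<in>F. PIdl a)" by blast
  qed
  then show "fin_gen_ideal T (\<Inter>a\<in>F. PIdl a)" using PIdl_fin_gen w by simp
qed

text \<open>Non-zero-divisors of \<open>A\<close> are lifted to non-zero elements \<open>f a\<close>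
  of \<open>R\<close>. For a common multiple \<open>x\<close> in \<open>A\<close>, the lifted
  quotients \<open>v a\<close> satisfy the cross relations modulo \<open>C\<close>. Patching yields
  \<open>y\<close> in \<open>T\<close> such that \<open>w \<otimes> y\<close> is a common multiple
  of the \<open>f a\<close> in \<open>R\<close> with image \<open>x\<close>.\<close>

lemma quasi_coherent_quotientI:
  assumes pp: "pp_ring A" and qc: "quasi_coherent R"
  shows "quasi_coherent A"
proof (rule A.pp_ring_quasi_coherentI[OF pp])
  fix F assume F: "finite F" "F \<noteq> {}" "\<And>a. a \<in> F \<Longrightarrow> non_zero_divisor A a"
  have Fc: "F \<subseteq> carrier A" using F(3) A.nzd_carrier by blast
  have "\<exists>r. r \<in> carrier R - {\<zero>} \<and> \<eta> r = a" if a: "a \<in> F" for a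
  proof -
    obtain r where r: "r \<in> carrier R" "\<eta> r = a" using a Fc \<eta>_surjE by blast
    \<comment> \<open>\<open>unimodular_multiple\<close> needs non-zero elements. If the lift
      happens to be zero, a non-zero element of \<open>C\<close> is another lift of
      \<open>a\<close>.\<close>
    obtain k where k: "k \<in> C" "k \<noteq> \<zero>" using nonzero CT.zero_closed by blast
    show ?thesis
    proof (cases "r = \<zero>")
      case True
      then have "\<eta> k = a" using r k \<eta>_zero \<eta>_zero_iff CR.Icarr by metis
      then show ?thesis using k CR.Icarr by blast
    qed (use r in blast)
  qed
  then have "\<forall>a\<in>F. \<exists>r. r \<in> carrier R - {\<zero>} \<and> \<eta> r = a" by blast
  from bchoice[OF this] obtain f where
    f: "\<And>a. a \<in> F \<Longrightarrow> f a \<in> carrier R" "\<And>a. a \<in> F \<Longrightarrow> f a \<noteq> \<zero>" "\<And>a. a \<in> F \<Longrightarrow> \<eta> (f a) = a"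
    by blast
  have "\<exists>u w. (\<forall>a\<in>f ` F. u a \<in> carrier R \<and> a \<otimes> u a = w) \<and> Idl (u ` f ` F) = carrier T"
    by (rule unimodular_multiple) (use F f sub_closed in auto)
  then obtain u' w where u': "\<forall>a\<in>f ` F. u' a \<in> carrier R \<and> a \<otimes> u' a = w"
    "Idl (u' ` f ` F) = carrier T" by blast
  define u where "u a = u' (f a)" for a
  have u: "\<And>a. a \<in> F \<Longrightarrow> u a \<in> carrier R" "\<And>a. a \<in> F \<Longrightarrow> f a \<otimes> u a = w"
    "Idl (u ` F) = carrier T"
    using u' by (auto simp: u_def image_image)
  obtain a0 where a0: "a0 \<in> F" using F(2) by blast
  have w: "w \<in> carrier R" using u(1,2)[OF a0] f(1)[OF a0] by auto
  have "fin_gen_ideal R (\<Inter>b\<in>f ` F. PIdl\<^bsub>R\<^esub> b)"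
    by (rule quasi_coherentD[OF qc]) (use F f in auto)
  then obtain G where G: "G \<subseteq> carrier R" "finite G" "(\<Inter>a\<in>F. PIdl\<^bsub>R\<^esub> (f a)) = Idl\<^bsub>R\<^esub> G"
    unfolding fin_gen_ideal_def by auto
  let ?G = "(\<lambda>x. \<eta> x) ` G"
  have Gc: "?G \<subseteq> carrier A" using G(1) by auto
  have "(\<Inter>a\<in>F. PIdl\<^bsub>A\<^esub> a) = Idl\<^bsub>A\<^esub> ?G"
  proof (intro equalityI subsetI)
    fix x assume x: "x \<in> (\<Inter>a\<in>F. PIdl\<^bsub>A\<^esub> a)"
    then have xi: "\<And>a. a \<in> F \<Longrightarrow> x \<in> PIdl\<^bsub>A\<^esub> a" by simp
    obtain t where t: "\<And>a. a \<in> F \<Longrightarrow> t a \<in> carrier A \<and> x = a \<otimes>\<^bsub>A\<^esub> t a"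
      using A.PIdl_Inter_quotients[OF Fc xi] by auto
    have "\<forall>a\<in>F. \<exists>v. v \<in> carrier R \<and> x = a \<otimes>\<^bsub>A\<^esub> \<eta> v"
    proof
      fix a assume a: "a \<in> F"
      then obtain v where "v \<in> carrier R" "\<eta> v = t a" using t \<eta>_surjE by metis
      then show "\<exists>v. v \<in> carrier R \<and> x = a \<otimes>\<^bsub>A\<^esub> \<eta> v" using t[OF a] by auto
    qed
    from bchoice[OF this] obtain v where v: "\<And>a. a \<in> F \<Longrightarrow> v a \<in> carrier R"
      "\<And>a. a \<in> F \<Longrightarrow> x = a \<otimes>\<^bsub>A\<^esub> \<eta> (v a)" by blast
    have xc: "x \<in> carrier A" using v(1,2)[OF a0] a0 Fc by auto
    have "v a \<otimes> u b \<ominus> v b \<otimes> u a \<in> C" if a: "a \<in> F" and b: "b \<in> F" for a b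
    proof -
      have c: "a \<in> carrier A" "b \<in> carrier A" "\<eta> (u a) \<in> carrier A" "\<eta> (u b) \<in> carrier A"
        "\<eta> (v a) \<in> carrier A" "\<eta> (v b) \<in> carrier A"
        using a b Fc u(1) v(1) by auto
      have w': "c \<otimes>\<^bsub>A\<^esub> \<eta> (u c) = \<eta> w" if "c \<in> F" for c
        using that u(1,2)[OF that] f(1,3)[OF that] by (metis \<eta>_mult)
      \<comment> \<open>The relation holds after multiplication by the product of \<open>a\<close>
        and \<open>b\<close>, which is a non-zero-divisor of \<open>A\<close>.\<close>
      have "(a \<otimes>\<^bsub>A\<^esub> b) \<otimes>\<^bsub>A\<^esub> (\<eta> (v a) \<otimes>\<^bsub>A\<^esub> \<eta> (u b)) =
          (a \<otimes>\<^bsub>A\<^esub> \<eta> (v a)) \<otimes>\<^bsub>A\<^esub> (b \<otimes>\<^bsub>A\<^esub> \<eta> (u b))"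
        using c by (simp add: A.m_ac)
      also have "\<dots> = (b \<otimes>\<^bsub>A\<^esub> \<eta> (v b)) \<otimes>\<^bsub>A\<^esub> (a \<otimes>\<^bsub>A\<^esub> \<eta> (u a))"
        using v(2) w' a b by metis
      also have "\<dots> = (a \<otimes>\<^bsub>A\<^esub> b) \<otimes>\<^bsub>A\<^esub> (\<eta> (v b) \<otimes>\<^bsub>A\<^esub> \<eta> (u a))"
        using c by (simp add: A.m_ac)
      finally have "\<eta> (v a) \<otimes>\<^bsub>A\<^esub> \<eta> (u b) = \<eta> (v b) \<otimes>\<^bsub>A\<^esub> \<eta> (u a)"
        using A.nzd_cancel[OF A.nzd_mult[OF F(3)[OF a] F(3)[OF b]]] c by simp
      then have "\<eta> (v a \<otimes> u b) = \<eta> (v b \<otimes> u a)" using \<eta>_mult a b u(1) v(1) by simp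
      then show ?thesis using \<eta>_eq_iff a b u(1) v(1) by simp
    qed
    then obtain y where y: "y \<in> carrier T" "\<And>a. a \<in> F \<Longrightarrow> y \<otimes> u a \<ominus> v a \<in> C"
      using unimodular_patching[OF ideal_T _ u(3), of v] u(1) v(1) sub_closed by blast
    \<comment> \<open>Being congruent to \<open>v a\<close> modulo \<open>C\<close>,
      \<open>y \<otimes> u a\<close> lies in \<open>R\<close> by the pullback property.\<close>
    have yu: "y \<otimes> u a \<in> carrier R \<and> \<eta> (y \<otimes> u a) = \<eta> (v a)" if a: "a \<in> F" for a
      using \<eta>_congruent[OF m_closed[OF y(1) sub_closed[OF u(1)[OF a]]] v(1)[OF a] y(2)[OF a]] .
    have wy: "w \<otimes> y = f a \<otimes> (y \<otimes> u a)" if a: "a \<in> F" for a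
      using u(1)[OF a] u(2)[OF a, symmetric] f(1)[OF a] y(1) sub_closed by (simp add: m_ac)
    have "w \<otimes> y \<in> PIdl\<^bsub>R\<^esub> (f a)" if a: "a \<in> F" for a
      using R.PIdl_iff[OF f(1)[OF a]] wy[OF a] yu[OF a] by blast
    then have "w \<otimes> y \<in> Idl\<^bsub>R\<^esub> G" using G(3) by blast
    then have "\<eta> (w \<otimes> y) \<in> Idl\<^bsub>A\<^esub> ?G" using \<eta>_genideal G(1) by blast
    moreover have "\<eta> (w \<otimes> y) = x"
      using \<eta>_mult[OF f(1)[OF a0], of "y \<otimes> u a0"] wy[OF a0] yu[OF a0] f(3)[OF a0] v(2)[OF a0]
      by simp
    ultimately show "x \<in> Idl\<^bsub>A\<^esub> ?G" by simp
  next
    have "?G \<subseteq> PIdl\<^bsub>A\<^esub> a" if a: "a \<in> F" for a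
    proof
      fix h assume "h \<in> ?G"
      then obtain g where g: "g \<in> G" "h = \<eta> g" by blast
      have "g \<in> PIdl\<^bsub>R\<^esub> (f a)" using R.genideal_self[OF G(1)] g(1) G(3) a by blast
      then obtain y where y: "y \<in> carrier R" "g = f a \<otimes> y" using R.PIdl_iff[OF f(1)[OF a]] by blast
      then have "h = a \<otimes>\<^bsub>A\<^esub> \<eta> y" using g(2) \<eta>_mult[OF f(1)[OF a] y(1)] f(3)[OF a] by simp
      then show "h \<in> PIdl\<^bsub>A\<^esub> a" using A.PIdl_iff[of a h] \<eta>_closed[OF y(1)] a Fc by blast
    qed
    then have "Idl\<^bsub>A\<^esub> ?G \<subseteq> (\<Inter>a\<in>F. PIdl\<^bsub>A\<^esub> a)"
      using Fc by (intro INT_greatest A.genideal_minimal A.cgenideal_ideal) auto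
    then show "x \<in> (\<Inter>a\<in>F. PIdl\<^bsub>A\<^esub> a)" if "x \<in> Idl\<^bsub>A\<^esub> ?G" for x using that by blast
  qed
  then show "fin_gen_ideal A (\<Inter>a\<in>F. PIdl\<^bsub>A\<^esub> a)"
    by (rule fin_gen_idealI[OF _ Gc finite_imageI[OF G(2)]])
qed

text \<open>Let \<open>V\<close> be the set of \<open>y\<close> in \<open>T\<close> with all
  \<open>y \<otimes> u a\<close> in \<open>R\<close>. The generators found for the intersection
  \<open>w V\<close> are \<open>w\<close> and the \<open>w \<otimes> g z\<close>, where
  \<open>g z\<close> in \<open>V\<close> is a lift, through multiplication by \<open>d\<close>, of a
  generator \<open>z\<close> of \<open>?W\<close>.\<close>

lemma quasi_coherent_subringI:
  assumes pp: "pp_ring A" and qc: "quasi_coherent A"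
  shows "quasi_coherent R"
proof (rule R.pp_ring_quasi_coherentI)
  show "pp_ring R" by (rule pp_ring_domain) (rule sub_domain)
  fix F assume F: "finite F" "F \<noteq> {}" "\<And>a. a \<in> F \<Longrightarrow> non_zero_divisor R a"
  have FR: "F \<subseteq> carrier R - {\<zero>}"
    by (rule subsetI) (rule iffD1[OF R.nzd_iff F(3)])
  then have F0: "F \<subseteq> carrier T - {\<zero>}" using sub_closed by blast
  obtain u w where u: "\<And>a. a \<in> F \<Longrightarrow> u a \<in> carrier R" "\<And>a. a \<in> F \<Longrightarrow> a \<otimes> u a = w"
    "Idl (u ` F) = carrier T"
    using unimodular_multiple[OF F(1,2) F0] by blast
  have uT: "\<And>a. a \<in> F \<Longrightarrow> u a \<in> carrier T" using u(1) sub_closed by blast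
  obtain a0 where a0: "a0 \<in> F" using F(2) by blast
  have w: "w \<in> carrier R" using u(1,2)[OF a0] FR a0 by auto
  have uc: "u ` F \<subseteq> carrier R" using u(1) by blast
  let ?U = "(\<lambda>x. \<eta> x) ` u ` F"
  have finU: "finite ?U" by (intro finite_imageI F(1))
  have Uc: "?U \<subseteq> carrier A" using u(1) \<eta>_closed by blast
  \<comment> \<open>In \<open>A\<close>, only zero annihilates all the \<open>\<eta> (u a)\<close>,
    so the element \<open>d'\<close> picked here will be a non-zero-divisor.\<close>
  from A.genideal_pick_annihilator[OF pp finU Uc] obtain d' where d': "d' \<in> Idl\<^bsub>A\<^esub> ?U"
    and d'_all: "\<forall>x\<in>carrier A. x \<otimes>\<^bsub>A\<^esub> d' = \<zero>\<^bsub>A\<^esub> \<longrightarrow> (\<forall>b\<in>?U. x \<otimes>\<^bsub>A\<^esub> b = \<zero>\<^bsub>A\<^esub>)"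
    by (rule bexE)
  have d'_ann: "x \<otimes>\<^bsub>A\<^esub> \<eta> (u a) = \<zero>\<^bsub>A\<^esub>"
    if "x \<in> carrier A" "x \<otimes>\<^bsub>A\<^esub> d' = \<zero>\<^bsub>A\<^esub>" "a \<in> F" for x a
    by (rule d'_all[rule_format, OF that(1,2)]) (intro imageI that(3))
  \<comment> \<open>The lift is taken in the ideal generated by the \<open>u a\<close>;
    \<open>d_mult\<close> depends on that.\<close>
  obtain d where d: "d \<in> Idl\<^bsub>R\<^esub> (u ` F)" "\<eta> d = d'" using \<eta>_genideal_lift[OF uc d'] by (rule bexE)
  have dc: "d \<in> carrier R" using R.genideal_closed(4)[OF uc d(1)] .
  have cancel: "x \<in> C" if "x \<in> carrier T" "\<And>a. a \<in> F \<Longrightarrow> u a \<otimes> x \<in> C" for x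
    using unimodular_cancel[OF ideal_T _ u(3), of x] uT that by blast
  \<comment> \<open>What annihilates \<open>\<eta> d\<close> annihilates every
    \<open>\<eta> (u a)\<close>. A lift \<open>z\<close> then satisfies
    \<open>u a \<otimes> z \<in> C\<close>, and since the \<open>u a\<close> generate the unit ideal
    of \<open>T\<close>, \<open>z\<close> lies in \<open>C\<close>.\<close>
  have nzd: "non_zero_divisor A (\<eta> d)"
    unfolding non_zero_divisor_def
  proof (intro conjI ballI impI)
    show "\<eta> d \<in> carrier A" using dc by simp
    fix x assume x: "x \<in> carrier A" "\<eta> d \<otimes>\<^bsub>A\<^esub> x = \<zero>\<^bsub>A\<^esub>"
    obtain z where z: "z \<in> carrier R" "\<eta> z = x" using \<eta>_surjE x(1) by blast
    have "u a \<otimes> z \<in> C" if a: "a \<in> F" for a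
    proof -
      have "x \<otimes>\<^bsub>A\<^esub> d' = \<zero>\<^bsub>A\<^esub>" using x(2) d(2) A.m_comm[OF x(1) \<eta>_closed[OF dc]] by simp
      then have "x \<otimes>\<^bsub>A\<^esub> \<eta> (u a) = \<zero>\<^bsub>A\<^esub>" using d'_ann[OF x(1) _ a] by blast
      then have "\<eta> (z \<otimes> u a) = \<zero>\<^bsub>A\<^esub>" using \<eta>_mult[OF z(1) u(1)[OF a]] z(2) by simp
      then show ?thesis using \<eta>_zero_iff z(1) u(1)[OF a] R.m_comm by (metis R.m_closed)
    qed
    then have "z \<in> C" using cancel sub_closed[OF z(1)] by blast
    then show "x = \<zero>\<^bsub>A\<^esub>" using \<eta>_zero_iff z by blast
  qed
  \<comment> \<open>\<open>d\<close> is a combination of the \<open>u a\<close> with coefficients in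
    \<open>R\<close>, so \<open>d \<otimes> y\<close> is the same combination of the
    \<open>y \<otimes> u a\<close>.\<close>
  have d_mult: "d \<otimes> y \<in> carrier R" if y: "y \<in> carrier T" "\<And>a. a \<in> F \<Longrightarrow> y \<otimes> u a \<in> carrier R" for y
    using uc d(1)
  proof (induction rule: R.genideal_induct)
    case (gen b)
    then show ?case using y uT by (auto simp: m_comm)
  next
    case zero
    then show ?case using y by simp
  next
    case (add s t)
    then show ?case using y(1) sub_closed by (simp add: l_distr)
  next
    case (mult r t)
    then show ?case using y(1) sub_closed by (simp add: m_assoc)
  qed
  \<comment> \<open>For \<open>y\<close> in \<open>V\<close>, \<open>u a\<close> times
    \<open>d \<otimes> y\<close> is \<open>d\<close> times \<open>y \<otimes> u a\<close>, which is
    an element of \<open>R\<close>. So the class of \<open>d \<otimes> y\<close> lies in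
    \<open>?W\<close>.\<close>
  let ?W = "{z \<in> carrier A. \<forall>b\<in>?U. b \<otimes>\<^bsub>A\<^esub> z \<in> PIdl\<^bsub>A\<^esub> (\<eta> d)}"
  have "fin_gen_ideal A ?W"
    by (rule A.pp_ring_quasi_coherent_quotient[OF pp qc finU Uc nzd])
  then obtain G where G: "G \<subseteq> carrier A" "finite G" "?W = Idl\<^bsub>A\<^esub> G"
    unfolding fin_gen_ideal_def by metis
  \<comment> \<open>Conversely, each generator of \<open>?W\<close> is the class of
    \<open>d \<otimes> g\<close> for some \<open>g\<close> in \<open>V\<close>: the quotients of the
    \<open>u a \<otimes> x\<close> by \<open>d\<close> modulo \<open>C\<close> are patched
    together.\<close>
  have "\<exists>g. g \<in> carrier T \<and> (\<forall>a\<in>F. g \<otimes> u a \<in> carrier R) \<and> \<eta> (d \<otimes> g) = z" if z: "z \<in> G" for z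
  proof -
    have "z \<in> ?W" unfolding G(3) using z A.genideal_self[OF G(1)] by blast
    then have zW: "z \<in> carrier A" "\<And>a. a \<in> F \<Longrightarrow> \<eta> (u a) \<otimes>\<^bsub>A\<^esub> z \<in> PIdl\<^bsub>A\<^esub> (\<eta> d)" by auto
    obtain x where x: "x \<in> carrier R" "\<eta> x = z" using zW(1) \<eta>_surjE by blast
    have "\<forall>a\<in>F. \<exists>v. v \<in> carrier R \<and> \<eta> (u a \<otimes> x) = \<eta> (d \<otimes> v)"
    proof
      fix a assume a: "a \<in> F"
      obtain t where t: "t \<in> carrier A" "\<eta> (u a) \<otimes>\<^bsub>A\<^esub> z = \<eta> d \<otimes>\<^bsub>A\<^esub> t"
        using zW(2)[OF a] A.PIdl_iff[OF \<eta>_closed[OF dc]] by blast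
      obtain v where v: "v \<in> carrier R" "\<eta> v = t" using t(1) \<eta>_surjE by blast
      have "\<eta> (u a \<otimes> x) = \<eta> (d \<otimes> v)" using t(2) v x dc u(1)[OF a] by (simp add: \<eta>_mult)
      then show "\<exists>v. v \<in> carrier R \<and> \<eta> (u a \<otimes> x) = \<eta> (d \<otimes> v)" using v(1) by blast
    qed
    from bchoice[OF this] obtain v where v: "\<And>a. a \<in> F \<Longrightarrow> v a \<in> carrier R"
      "\<And>a. a \<in> F \<Longrightarrow> \<eta> (u a \<otimes> x) = \<eta> (d \<otimes> v a)" by blast
    have "v a \<otimes> u b \<ominus> v b \<otimes> u a \<in> C" if a: "a \<in> F" and b: "b \<in> F" for a b
    proof -
      note c = u(1)[OF a] u(1)[OF b] v(1)[OF a] v(1)[OF b]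
      have "\<eta> d \<otimes>\<^bsub>A\<^esub> \<eta> (v a \<otimes> u b) = \<eta> (d \<otimes> v a) \<otimes>\<^bsub>A\<^esub> \<eta> (u b)"
        using c dc by (simp add: \<eta>_mult A.m_assoc)
      also have "\<dots> = \<eta> (u a \<otimes> x) \<otimes>\<^bsub>A\<^esub> \<eta> (u b)" using v(2)[OF a] by simp
      also have "\<dots> = \<eta> (u b \<otimes> x) \<otimes>\<^bsub>A\<^esub> \<eta> (u a)" using c x zW(1) by (simp add: \<eta>_mult A.m_ac)
      also have "\<dots> = \<eta> (d \<otimes> v b) \<otimes>\<^bsub>A\<^esub> \<eta> (u a)" using v(2)[OF b] by simp
      also have "\<dots> = \<eta> d \<otimes>\<^bsub>A\<^esub> \<eta> (v b \<otimes> u a)"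
        using c dc by (simp add: \<eta>_mult A.m_assoc)
      finally have "\<eta> (v a \<otimes> u b) = \<eta> (v b \<otimes> u a)"
        using A.nzd_cancel[OF nzd] c by simp
      then show ?thesis using \<eta>_eq_iff c by simp
    qed
    then obtain y where y: "y \<in> carrier T" "\<And>a. a \<in> F \<Longrightarrow> y \<otimes> u a \<ominus> v a \<in> C"
      using unimodular_patching[OF ideal_T _ u(3), of v] uT v(1) sub_closed by blast
    have yu: "y \<otimes> u a \<in> carrier R \<and> \<eta> (y \<otimes> u a) = \<eta> (v a)" if a: "a \<in> F" for a
      using \<eta>_congruent[OF m_closed[OF y(1) sub_closed[OF u(1)[OF a]]] v(1)[OF a] y(2)[OF a]] .
    have dy: "d \<otimes> y \<in> carrier R" using d_mult y(1) yu by blast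
    \<comment> \<open>\<open>d \<otimes> y\<close> and the lift \<open>x\<close> of \<open>z\<close>
      agree modulo \<open>C\<close> after multiplication by each \<open>u a\<close>, hence they
      agree modulo \<open>C\<close>.\<close>
    have "u a \<otimes> (d \<otimes> y \<ominus> x) \<in> C" if a: "a \<in> F" for a
    proof -
      have "\<eta> (u a \<otimes> (d \<otimes> y)) = \<eta> (d \<otimes> (y \<otimes> u a))"
        using y(1) uT[OF a] sub_closed[OF dc] by (simp add: m_ac)
      also have "\<dots> = \<eta> (u a \<otimes> x)" using yu[OF a] dc v(1,2)[OF a] by (simp add: \<eta>_mult)
      finally have "u a \<otimes> (d \<otimes> y) \<ominus> u a \<otimes> x \<in> C"
        using \<eta>_eq_iff dy x(1) u(1)[OF a] by simp
      then show ?thesis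
        using y(1) uT[OF a] sub_closed[OF dc] sub_closed[OF x(1)]
        by (simp add: a_minus_def r_distr r_minus)
    qed
    then have "d \<otimes> y \<ominus> x \<in> C"
      using cancel y(1) sub_closed[OF dc] sub_closed[OF x(1)] by simp
    then have "\<eta> (d \<otimes> y) = z" using \<eta>_eq_iff[OF dy x(1)] x(2) by simp
    then show ?thesis using y(1) yu by blast
  qed
  then have "\<forall>z\<in>G. \<exists>g. g \<in> carrier T \<and> (\<forall>a\<in>F. g \<otimes> u a \<in> carrier R) \<and> \<eta> (d \<otimes> g) = z" by blast
  from bchoice[OF this] obtain g where g: "\<And>z. z \<in> G \<Longrightarrow> g z \<in> carrier T"
    "\<And>z a. z \<in> G \<Longrightarrow> a \<in> F \<Longrightarrow> g z \<otimes> u a \<in> carrier R" "\<And>z. z \<in> G \<Longrightarrow> \<eta> (d \<otimes> g z) = z"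
    by blast
  \<comment> \<open>\<open>w\<close> is admissible because \<open>\<one>\<close> lies in
    \<open>V\<close>; it will absorb errors in \<open>C\<close>.\<close>
  let ?G = "insert w ((\<lambda>z. w \<otimes> g z) ` G)"
  have w_mult: "w \<otimes> y = a \<otimes> (y \<otimes> u a)" if "a \<in> F" "y \<in> carrier T" for a y
    using u(2)[OF that(1), symmetric] uT[OF that(1)] F0 that by (auto simp: m_ac)
  have w_mem: "w \<otimes> y \<in> PIdl\<^bsub>R\<^esub> a" if "a \<in> F" "y \<in> carrier T" "y \<otimes> u a \<in> carrier R" for a y
  proof -
    have "a \<in> carrier R" using that(1) FR by blast
    then show ?thesis using R.PIdl_iff[of a] w_mult[OF that(1,2)] that(3) by blast
  qed
  have G_mem: "h \<in> PIdl\<^bsub>R\<^esub> a" if "h \<in> ?G" and a: "a \<in> F" for h a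
  proof (cases "h = w")
    case True
    have "w \<otimes> \<one> \<in> PIdl\<^bsub>R\<^esub> a" by (rule w_mem[OF a]) (use u(1)[OF a] uT[OF a] in auto)
    then show ?thesis using True sub_closed[OF w] by simp
  next
    case False
    then obtain z where "z \<in> G" "h = w \<otimes> g z" using \<open>h \<in> ?G\<close> by blast
    then show ?thesis using w_mem[OF a] g(1,2) a by blast
  qed
  have Gc: "?G \<subseteq> carrier R"
  proof
    fix h assume "h \<in> ?G"
    then have "h \<in> PIdl\<^bsub>R\<^esub> a0" using G_mem a0 by blast
    moreover have "ideal (PIdl\<^bsub>R\<^esub> a0) R" using R.cgenideal_ideal[of a0] a0 FR by blast
    ultimately show "h \<in> carrier R" using ideal.Icarr by fastforce
  qed
  have "(\<Inter>a\<in>F. PIdl\<^bsub>R\<^esub> a) = Idl\<^bsub>R\<^esub> ?G"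
  proof (intro equalityI subsetI)
    fix x assume "x \<in> (\<Inter>a\<in>F. PIdl\<^bsub>R\<^esub> a)"
    then obtain v where v: "\<And>a. a \<in> F \<Longrightarrow> v a \<in> carrier R \<and> x = a \<otimes> v a"
      using R.PIdl_Inter_quotients[of F x] FR by blast
    then obtain y where y: "y \<in> carrier T" "x = w \<otimes> y" "\<And>a. a \<in> F \<Longrightarrow> y \<otimes> u a = v a"
      using common_quotient[OF F(2) F0 uT u(2,3), of v x] sub_closed by blast
    then have yu: "\<And>a. a \<in> F \<Longrightarrow> y \<otimes> u a \<in> carrier R" using v by simp
    have dy: "d \<otimes> y \<in> carrier R" using d_mult y(1) yu by blast
    have "\<eta> (u a) \<otimes>\<^bsub>A\<^esub> \<eta> (d \<otimes> y) \<in> PIdl\<^bsub>A\<^esub> (\<eta> d)" if a: "a \<in> F" for a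
    proof -
      have "u a \<otimes> (d \<otimes> y) = d \<otimes> (y \<otimes> u a)"
        using y(1) uT[OF a] sub_closed[OF dc] by (simp add: m_ac)
      then have "\<eta> (u a) \<otimes>\<^bsub>A\<^esub> \<eta> (d \<otimes> y) = \<eta> d \<otimes>\<^bsub>A\<^esub> \<eta> (y \<otimes> u a)"
        using \<eta>_mult[OF u(1)[OF a] dy] \<eta>_mult[OF dc yu[OF a]] by simp
      then show ?thesis using A.PIdl_iff[OF \<eta>_closed[OF dc]] \<eta>_closed[OF yu[OF a]] by blast
    qed
    then have "\<eta> (d \<otimes> y) \<in> Idl\<^bsub>A\<^esub> G" using \<eta>_closed[OF dy] by (subst G(3)[symmetric]) auto
    \<comment> \<open>The induction runs over an arbitrary element of \<open>Idl G\<close> in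
      \<open>A\<close>: it is the class of \<open>d \<otimes> h\<close> for some \<open>h\<close> in
      \<open>V\<close> with \<open>w \<otimes> h\<close> in the ideal of \<open>?G\<close>.\<close>
    with G(1) have "\<exists>h\<in>carrier T. (\<forall>a\<in>F. h \<otimes> u a \<in> carrier R) \<and> \<eta> (d \<otimes> h) = \<eta> (d \<otimes> y) \<and>
        w \<otimes> h \<in> Idl\<^bsub>R\<^esub> ?G"
    proof (induction rule: A.genideal_induct)
      case (gen z)
      have "w \<otimes> g z \<in> Idl\<^bsub>R\<^esub> ?G" using R.genideal_self[OF Gc] gen by blast
      then show ?case using g gen by blast
    next
      case zero
      show ?case
        using R.genideal_closed(1)[OF Gc] uT sub_closed[OF w] sub_closed[OF dc] \<eta>_zero
        by (intro bexI[of _ \<zero>]) auto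
    next
      case (add s t)
      obtain h where h: "h \<in> carrier T" "\<And>a. a \<in> F \<Longrightarrow> h \<otimes> u a \<in> carrier R" "\<eta> (d \<otimes> h) = s"
        "w \<otimes> h \<in> Idl\<^bsub>R\<^esub> ?G" using add.IH by blast
      obtain k where k: "k \<in> carrier T" "\<And>a. a \<in> F \<Longrightarrow> k \<otimes> u a \<in> carrier R" "\<eta> (d \<otimes> k) = t"
        "w \<otimes> k \<in> Idl\<^bsub>R\<^esub> ?G" using add.IH by blast
      have "(h \<oplus> k) \<otimes> u a \<in> carrier R" if "a \<in> F" for a
        using h(1) k(1) h(2)[OF that] k(2)[OF that] uT[OF that] by (simp add: l_distr)
      moreover have "\<eta> (d \<otimes> (h \<oplus> k)) = s \<oplus>\<^bsub>A\<^esub> t"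
        using h k sub_closed[OF dc] d_mult[OF h(1,2)] d_mult[OF k(1,2)] by (simp add: r_distr \<eta>_add)
      moreover have "w \<otimes> (h \<oplus> k) \<in> Idl\<^bsub>R\<^esub> ?G"
        using h k sub_closed[OF w] R.genideal_closed(2)[OF Gc h(4) k(4)] by (simp add: r_distr)
      ultimately show ?case using h(1) k(1) by (intro bexI[of _ "h \<oplus> k"]) auto
    next
      case (mult r t)
      obtain h where h: "h \<in> carrier T" "\<And>a. a \<in> F \<Longrightarrow> h \<otimes> u a \<in> carrier R" "\<eta> (d \<otimes> h) = t"
        "w \<otimes> h \<in> Idl\<^bsub>R\<^esub> ?G" using mult.IH by blast
      obtain q where q: "q \<in> carrier R" "\<eta> q = r" using mult.hyps(1) \<eta>_surjE by blast
      note qT = sub_closed[OF q(1)]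
      have "(q \<otimes> h) \<otimes> u a \<in> carrier R" if "a \<in> F" for a
        using h(1) h(2)[OF that] uT[OF that] q(1) qT by (simp add: m_assoc)
      moreover have "\<eta> (d \<otimes> (q \<otimes> h)) = r \<otimes>\<^bsub>A\<^esub> t"
        using h(1,3) qT sub_closed[OF dc] \<eta>_mult[OF q(1) d_mult[OF h(1,2)]] q(2)
        by (simp add: m_lcomm[of d q h])
      moreover have "w \<otimes> (q \<otimes> h) \<in> Idl\<^bsub>R\<^esub> ?G"
        using h(1) qT sub_closed[OF w] R.genideal_closed(3)[OF Gc q(1) h(4)]
        by (simp add: m_lcomm[of w q h])
      ultimately show ?case using h(1) qT by (intro bexI[of _ "q \<otimes> h"]) auto
    qed
    then obtain h where h: "h \<in> carrier T" "\<And>a. a \<in> F \<Longrightarrow> h \<otimes> u a \<in> carrier R"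
      "\<eta> (d \<otimes> h) = \<eta> (d \<otimes> y)" "w \<otimes> h \<in> Idl\<^bsub>R\<^esub> ?G" by blast
    have dh: "d \<otimes> h \<in> carrier R" using d_mult h(1,2) by blast
    \<comment> \<open>\<open>d \<otimes> h\<close> and \<open>d \<otimes> y\<close> have the same
      class; the non-zero-divisor \<open>\<eta> d\<close> can be cancelled once \<open>u a\<close>
      has brought \<open>h\<close> and \<open>y\<close> into \<open>R\<close>.\<close>
    have "u a \<otimes> (y \<ominus> h) \<in> C" if a: "a \<in> F" for a
    proof -
      have "\<eta> d \<otimes>\<^bsub>A\<^esub> \<eta> (k \<otimes> u a) = \<eta> (u a) \<otimes>\<^bsub>A\<^esub> \<eta> (d \<otimes> k)"
        if "k \<in> carrier T" "k \<otimes> u a \<in> carrier R" "d \<otimes> k \<in> carrier R" for k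
      proof -
        have "d \<otimes> (k \<otimes> u a) = u a \<otimes> (d \<otimes> k)"
          using that(1) uT[OF a] sub_closed[OF dc] by (simp add: m_ac)
        then show ?thesis using \<eta>_mult[OF dc that(2)] \<eta>_mult[OF u(1)[OF a] that(3)] by simp
      qed
      from this[OF y(1) yu[OF a] dy] this[OF h(1) h(2)[OF a] dh]
      have "\<eta> d \<otimes>\<^bsub>A\<^esub> \<eta> (y \<otimes> u a) = \<eta> d \<otimes>\<^bsub>A\<^esub> \<eta> (h \<otimes> u a)" using h(3) by simp
      then have "\<eta> (y \<otimes> u a) = \<eta> (h \<otimes> u a)"
        using A.nzd_cancel[OF nzd] yu[OF a] h(2)[OF a] by simp
      then have "y \<otimes> u a \<ominus> h \<otimes> u a \<in> C" using \<eta>_eq_iff yu[OF a] h(2)[OF a] by blast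
      moreover have "u a \<otimes> (y \<ominus> h) = y \<otimes> u a \<ominus> h \<otimes> u a"
        using y(1) h(1) uT[OF a] by algebra
      ultimately show ?thesis by simp
    qed
    then have "y \<ominus> h \<in> C" using cancel y(1) h(1) by simp
    \<comment> \<open>The error \<open>y \<ominus> h\<close> lies in \<open>C\<close>, hence in
      \<open>R\<close>, and is a legitimate coefficient of the generator \<open>w\<close>.\<close>
    then have "(y \<ominus> h) \<otimes> w \<in> Idl\<^bsub>R\<^esub> ?G"
      using R.genideal_closed(3)[OF Gc] CR.Icarr R.genideal_self[OF Gc] by blast
    then have "w \<otimes> h \<oplus> (y \<ominus> h) \<otimes> w \<in> Idl\<^bsub>R\<^esub> ?G"
      using R.genideal_closed(2)[OF Gc h(4)] by blast
    moreover have "w \<otimes> h \<oplus> (y \<ominus> h) \<otimes> w = x"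
      unfolding y(2) using y(1) h(1) sub_closed[OF w] by algebra
    ultimately show "x \<in> Idl\<^bsub>R\<^esub> ?G" by simp
  next
    have "Idl\<^bsub>R\<^esub> ?G \<subseteq> PIdl\<^bsub>R\<^esub> a" if a: "a \<in> F" for a
    proof (rule R.genideal_minimal)
      show "ideal (PIdl\<^bsub>R\<^esub> a) R" using R.cgenideal_ideal[of a] a FR by blast
      show "?G \<subseteq> PIdl\<^bsub>R\<^esub> a" using G_mem a by blast
    qed
    then show "x \<in> (\<Inter>a\<in>F. PIdl\<^bsub>R\<^esub> a)" if "x \<in> Idl\<^bsub>R\<^esub> ?G" for x using that by blast
  qed
  then show "fin_gen_ideal R (\<Inter>a\<in>F. PIdl\<^bsub>R\<^esub> a)"
    by (rule fin_gen_idealI[OF _ Gc]) (simp add: G(2))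
qed

end

section \<open>Consequences of the condition on finitely generated ideals\<close>

text \<open>\<open>scaling\<close> makes \<open>s\<close> a non-zero-divisor of \<open>T\<close>.
  Principal ideals then show that non-zero elements of \<open>R\<close> are non-zero-divisors of
  \<open>T\<close>, and a regular element of \<open>C\<close> extends this to all of
  \<open>T\<close>. Finally the ideal of \<open>R\<close> generated by the multiples
  \<open>k p / a\<close> of the inverses gives the family \<open>u\<close>.\<close>

lemma domain_conductor_squareI:
  fixes T :: "('a, 'b) ring_scheme" (structure) and R C
  assumes square: "regular_conductor_square T R C"
    and cond: "\<And>I. fin_gen_ideal R I \<Longrightarrow> I \<noteq> {\<zero>} \<Longrightarrow>
      \<exists>r\<in>carrier R. \<exists>s\<in>carrier R. \<exists>U. ideal U R \<and> Idl U = carrier T \<and>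
        r <#\<^bsub>R\<^esub> I = s <#\<^bsub>R\<^esub> U \<and> inj_on (\<lambda>x. s \<otimes>\<^bsub>R\<^esub> x) U"
  shows "domain_conductor_square T R C"
proof -
  interpret regular_conductor_square T R C by (rule square)
  interpret T: cring T by (rule cring_T)
  interpret R: cring R
    rewrites "(\<otimes>\<^bsub>R\<^esub>) = (\<otimes>)" and "(\<oplus>\<^bsub>R\<^esub>) = (\<oplus>)" and "\<one>\<^bsub>R\<^esub> = \<one>" and "\<zero>\<^bsub>R\<^esub> = \<zero>"
    by (simp_all add: sub_cring sub_simps)
  interpret CT: ideal C T by (rule ideal_T)
  have sub: "x \<in> carrier T" if "x \<in> carrier R" for x
    using subringE(1)[OF sub_carrier] that by blast
  have CR: "x \<in> carrier R" if "x \<in> C" for x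
    using ideal.Icarr[OF ideal_R that] .
  obtain k where k: "k \<in> C" "non_zero_divisor T k" using regular by blast
  have kc: "k \<in> carrier T" using k(2) by (rule T.nzd_carrier)

  have scaling: "\<exists>r\<in>carrier R. \<exists>s. non_zero_divisor T s \<and> (\<exists>U\<subseteq>carrier R. Idl U = carrier T \<and>
      (\<forall>i\<in>I. \<exists>x\<in>U. r \<otimes> i = s \<otimes> x) \<and> (\<forall>x\<in>U. \<exists>i\<in>I. s \<otimes> x = r \<otimes> i))"
    if I: "fin_gen_ideal R I" "I \<noteq> {\<zero>}" for I
  proof -
    from cond[OF I] obtain r s U where r: "r \<in> carrier R" and s: "s \<in> carrier R"
      and U: "ideal U R" "Idl U = carrier T"
      and rI: "r <#\<^bsub>R\<^esub> I = s <#\<^bsub>R\<^esub> U" and inj: "inj_on (\<lambda>x. s \<otimes>\<^bsub>R\<^esub> x) U"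
      by blast
    interpret U: ideal U R by (rule U(1))
    have UR: "U \<subseteq> carrier R" using U.Icarr by blast
    have UT: "U \<subseteq> carrier T" using UR sub by blast
    have eq: "(\<Union>i\<in>I. {r \<otimes> i}) = (\<Union>x\<in>U. {s \<otimes> x})"
      using rI unfolding l_coset_def sub_simps .
    have sT: "s \<in> carrier T" using s sub by blast
    have "x = \<zero>" if x: "x \<in> carrier T" "s \<otimes> x = \<zero>" for x
    proof -
      \<comment> \<open>\<open>x \<otimes> k\<close> lies in \<open>C\<close>, so
        \<open>u \<otimes> (x \<otimes> k)\<close> stays in \<open>U\<close>, where multiplication
        by \<open>s\<close> is injective. As \<open>U\<close> generates the unit ideal and
        \<open>k\<close> is regular, \<open>x\<close> is zero.\<close>
      have xk: "x \<otimes> k \<in> C" using CT.I_l_closed[OF k(1) x(1)] .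
      have "u \<otimes> (x \<otimes> k) \<in> {\<zero>}" if u: "u \<in> U" for u
      proof -
        have uT: "u \<in> carrier T" using u UT by blast
        have "u \<otimes> (x \<otimes> k) \<in> U" using U.I_r_closed[OF u CR[OF xk]] by (simp add: sub_simps)
        moreover have "s \<otimes> (u \<otimes> (x \<otimes> k)) = u \<otimes> (s \<otimes> x) \<otimes> k"
          using uT x(1) sT kc by (simp add: T.m_ac)
        then have "s \<otimes> (u \<otimes> (x \<otimes> k)) = s \<otimes> \<zero>" using x(2) uT sT kc by simp
        moreover have "\<zero> \<in> U" using U.zero_closed by (simp add: sub_simps)
        ultimately show ?thesis using inj unfolding sub_simps inj_on_def by blast
      qed
      then have "x \<otimes> k \<in> {\<zero>}"
        using T.unimodular_cancel[OF T.zeroideal UT U(2)] x(1) kc by simp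
      then have "k \<otimes> x = \<zero>" using x(1) kc by (simp add: T.m_comm)
      then show ?thesis using T.nzdD[OF k(2) x(1)] by blast
    qed
    then have "non_zero_divisor T s" using sT by (simp add: non_zero_divisor_def)
    moreover have "\<forall>i\<in>I. \<exists>x\<in>U. r \<otimes> i = s \<otimes> x" using eq by blast
    moreover have "\<forall>x\<in>U. \<exists>i\<in>I. s \<otimes> x = r \<otimes> i" using eq by blast
    ultimately show ?thesis using r UR U(2) by blast
  qed

  have nzd_R: "non_zero_divisor T a" if a: "a \<in> carrier R" "a \<noteq> \<zero>" for a
  proof -
    have "PIdl\<^bsub>R\<^esub> a \<noteq> {\<zero>}" using R.cgenideal_self[OF a(1)] a(2) by blast
    from scaling[OF R.PIdl_fin_gen[OF a(1)] this]
    obtain r s U where r: "r \<in> carrier R" and s: "non_zero_divisor T s"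
      and U: "U \<subseteq> carrier R" "Idl U = carrier T"
      and sU: "\<forall>x\<in>U. \<exists>i\<in>PIdl\<^bsub>R\<^esub> a. s \<otimes> x = r \<otimes> i" by blast
    have UT: "U \<subseteq> carrier T" using U(1) sub by blast
    have aT: "a \<in> carrier T" using a sub by blast
    have "x = \<zero>" if x: "x \<in> carrier T" "a \<otimes> x = \<zero>" for x
    proof -
      \<comment> \<open>\<open>s \<otimes> u\<close> is a multiple of \<open>a\<close>, so it kills
        \<open>x\<close>; cancelling \<open>s\<close> leaves
        \<open>u \<otimes> x = \<zero>\<close>.\<close>
      have "u \<otimes> x \<in> {\<zero>}" if u: "u \<in> U" for u
      proof -
        from sU u have "\<exists>i\<in>PIdl\<^bsub>R\<^esub> a. s \<otimes> u = r \<otimes> i" by (rule bspec)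
        then obtain i where i: "i \<in> PIdl\<^bsub>R\<^esub> a" "s \<otimes> u = r \<otimes> i" by (rule bexE)
        obtain b where "b \<in> carrier R" "i = a \<otimes> b"
          using iffD1[OF R.PIdl_iff[OF a(1)] i(1)] by (rule bexE)
        with i(2) have b: "b \<in> carrier R" "s \<otimes> u = r \<otimes> (a \<otimes> b)" by simp_all
        have uT: "u \<in> carrier T" using u UT by blast
        have "s \<otimes> (u \<otimes> x) = (s \<otimes> u) \<otimes> x"
          using uT x(1) T.nzd_carrier[OF s] by (simp add: T.m_assoc)
        also have "\<dots> = r \<otimes> b \<otimes> (a \<otimes> x)"
          unfolding b(2) using sub[OF r] sub[OF b(1)] aT x(1) by (simp add: T.m_ac)
        also have "\<dots> = \<zero>" using x(2) sub[OF r] sub[OF b(1)] by simp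
        finally show ?thesis using T.nzdD[OF s, of "u \<otimes> x"] uT x(1) by simp
      qed
      then show ?thesis using T.unimodular_cancel[OF T.zeroideal UT U(2) x(1)] by simp
    qed
    then show ?thesis using aT by (simp add: non_zero_divisor_def)
  qed

  have nzd_T: "non_zero_divisor T t" if t: "t \<in> carrier T" "t \<noteq> \<zero>" for t
  proof -
    \<comment> \<open>\<open>k\<close> moves \<open>t\<close> into \<open>R\<close> without killing
      it.\<close>
    have "k \<otimes> t \<noteq> \<zero>" using T.nzdD[OF k(2) t(1)] t(2) by blast
    moreover have "k \<otimes> t \<in> carrier R" using CT.I_r_closed[OF k(1) t(1)] CR by blast
    ultimately have "non_zero_divisor T (k \<otimes> t)" using nzd_R by blast
    then show ?thesis using T.nzd_factor[OF _ kc t(1)] by blast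
  qed
  have one: "\<one> \<noteq> \<zero>"
  proof
    assume "\<one> = \<zero>"
    then have "carrier T = {\<zero>}" using T.carrier_one_zero by blast
    then have "C = {\<zero>}" using CT.Icarr CT.zero_closed by blast
    then show False using nonzero by blast
  qed
  interpret dom: "domain" T
  proof
    show "\<one> \<noteq> \<zero>" by (rule one)
    show "a = \<zero> \<or> b = \<zero>" if "a \<otimes> b = \<zero>" "a \<in> carrier T" "b \<in> carrier T" for a b
      using T.nzdD[OF nzd_T[OF that(2)] that(3,1)] by blast
  qed
  show ?thesis
  proof
    fix F assume F: "finite F" "F \<noteq> {}" "F \<subseteq> carrier T - {\<zero>}"
    have nzdF: "non_zero_divisor T a" if "a \<in> F" for a using nzd_T F(3) that by blast
    obtain p q where p: "non_zero_divisor T p"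
      and q: "\<And>a. a \<in> F \<Longrightarrow> q a \<in> carrier T" "\<And>a. a \<in> F \<Longrightarrow> a \<otimes> q a = p"
      using T.common_multiple[OF F(1) nzdF] by blast
    have FT: "a \<in> carrier T" if "a \<in> F" for a using F(3) that by blast
    have pT: "p \<in> carrier T" using p by (rule T.nzd_carrier)
    \<comment> \<open>\<open>k \<otimes> q a\<close> stands for \<open>k p / a\<close>; the factor
      \<open>k\<close> brings it into \<open>C\<close> and thus into \<open>R\<close>.\<close>
    let ?F = "(\<lambda>a. k \<otimes> q a) ` F"
    have kq: "k \<otimes> q a \<in> carrier R" if "a \<in> F" for a
      using CT.I_r_closed[OF k(1) q(1)[OF that]] CR by blast
    then have FR: "?F \<subseteq> carrier R" by blast
    let ?I = "Idl\<^bsub>R\<^esub> ?F"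
    have fg: "fin_gen_ideal R ?I"
      unfolding fin_gen_ideal_def using FR F(1) by (intro exI[of _ ?F]) simp
    obtain a0 where a0: "a0 \<in> F" using F(2) by blast
    have "non_zero_divisor T (q a0)"
      using T.nzd_factor[of a0 "q a0"] q[OF a0] p FT[OF a0] by simp
    then have "k \<otimes> q a0 \<noteq> \<zero>"
      using T.nzd_mult[OF k(2)] dom.nzd_iff by blast
    moreover have "k \<otimes> q a0 \<in> ?I" using R.genideal_self[OF FR] a0 by blast
    ultimately have "?I \<noteq> {\<zero>}" by blast
    from scaling[OF fg this]
    obtain r s U where r: "r \<in> carrier R" and s: "non_zero_divisor T s"
      and U: "U \<subseteq> carrier R" "Idl U = carrier T"
      and rI: "\<forall>i\<in>?I. \<exists>x\<in>U. r \<otimes> i = s \<otimes> x"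
      and sU: "\<forall>x\<in>U. \<exists>i\<in>?I. s \<otimes> x = r \<otimes> i" by blast
    have sT: "s \<in> carrier T" using s by (rule T.nzd_carrier)
    have rT: "r \<in> carrier T" using r sub by blast
    have "\<forall>a\<in>F. \<exists>u. u \<in> U \<and> r \<otimes> (k \<otimes> q a) = s \<otimes> u"
    proof
      fix a assume "a \<in> F"
      then have "k \<otimes> q a \<in> ?I" using R.genideal_self[OF FR] by blast
      then show "\<exists>u. u \<in> U \<and> r \<otimes> (k \<otimes> q a) = s \<otimes> u" using rI by blast
    qed
    from bchoice[OF this] obtain u where u: "\<And>a. a \<in> F \<Longrightarrow> u a \<in> U"
      "\<And>a. a \<in> F \<Longrightarrow> r \<otimes> (k \<otimes> q a) = s \<otimes> u a" by blast
    have uR: "u a \<in> carrier R" if "a \<in> F" for a using u(1)[OF that] U(1) by blast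
    have uT: "u a \<in> carrier T" if "a \<in> F" for a using uR[OF that] sub by blast
    then have uF: "u ` F \<subseteq> carrier T" by blast
    \<comment> \<open>The product with \<open>s\<close> does not depend on \<open>a\<close>, and
      \<open>s\<close> cancels; the common value of the \<open>a \<otimes> u a\<close> becomes
      \<open>w\<close>.\<close>
    have s_au: "s \<otimes> (a \<otimes> u a) = r \<otimes> (k \<otimes> p)" if a: "a \<in> F" for a
    proof -
      have "s \<otimes> (a \<otimes> u a) = a \<otimes> (s \<otimes> u a)" using sT FT[OF a] uT[OF a] by (simp add: T.m_lcomm)
      also have "\<dots> = r \<otimes> (k \<otimes> (a \<otimes> q a))"
        unfolding u(2)[OF a, symmetric] using rT kc FT[OF a] q(1)[OF a] by (simp add: T.m_ac)
      finally show ?thesis using q(2)[OF a] by simp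
    qed
    have au: "a \<otimes> u a = a0 \<otimes> u a0" if a: "a \<in> F" for a
      by (rule T.nzd_cancel[OF s]) (use s_au[OF a] s_au[OF a0] FT[OF a] FT[OF a0] uT[OF a] uT[OF a0] in auto)
    \<comment> \<open>\<open>r\<close> times \<open>?I\<close> is contained in \<open>s\<close>
      times the ideal of \<open>T\<close> generated by the \<open>u a\<close>. Since
      \<open>s \<otimes> x\<close> lies in the former for each \<open>x\<close> in \<open>U\<close>,
      cancelling \<open>s\<close> puts \<open>U\<close> into that ideal, which is therefore the unit
      ideal.\<close>
    have r_mem: "\<exists>t\<in>Idl (u ` F). r \<otimes> i = s \<otimes> t" if i: "i \<in> ?I" for i
      using FR i
    proof (induction rule: R.genideal_induct)
      case (gen b)
      then obtain a where "a \<in> F" "b = k \<otimes> q a" by blast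
      then show ?case using u(2)[of a] T.genideal_self[OF uF] by blast
    next
      case zero
      show ?case using T.genideal_closed(1)[OF uF] rT sT by (intro bexI[of _ \<zero>]) auto
    next
      case (add x y)
      obtain x' where x': "x' \<in> Idl (u ` F)" "r \<otimes> x = s \<otimes> x'" using add.IH by blast
      obtain y' where y': "y' \<in> Idl (u ` F)" "r \<otimes> y = s \<otimes> y'" using add.IH by blast
      have "r \<otimes> (x \<oplus> y) = s \<otimes> (x' \<oplus> y')"
        using x' y' rT sT sub[OF add.hyps(1)] sub[OF add.hyps(2)] T.genideal_closed(4)[OF uF]
        by (simp add: T.r_distr)
      then show ?case using T.genideal_closed(2)[OF uF x'(1) y'(1)] by blast
    next
      case (mult c x)
      obtain x' where x': "x' \<in> Idl (u ` F)" "r \<otimes> x = s \<otimes> x'" using mult.IH by blast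
      note c = sub[OF mult.hyps(1)] sub[OF mult.hyps(2)] T.genideal_closed(4)[OF uF x'(1)]
      have "r \<otimes> (c \<otimes> x) = c \<otimes> (r \<otimes> x)" using c rT by (simp add: T.m_lcomm)
      also have "\<dots> = s \<otimes> (c \<otimes> x')" unfolding x'(2) using c sT by (simp add: T.m_lcomm)
      finally show ?case using T.genideal_closed(3)[OF uF c(1) x'(1)] by blast
    qed
    have "U \<subseteq> Idl (u ` F)"
    proof
      fix x assume x: "x \<in> U"
      then obtain i where i: "i \<in> ?I" "s \<otimes> x = r \<otimes> i" using sU by blast
      then obtain t where t: "t \<in> Idl (u ` F)" "r \<otimes> i = s \<otimes> t" using r_mem by blast
      have "x \<in> carrier T" using x U(1) sub by blast
      then have "x = t" using T.nzd_cancel[OF s] i(2) t T.genideal_closed(4)[OF uF] by simp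
      then show "x \<in> Idl (u ` F)" using t(1) by simp
    qed
    then have "carrier T \<subseteq> Idl (u ` F)"
      unfolding U(2)[symmetric] by (rule T.genideal_minimal[OF T.genideal_ideal[OF uF]])
    then have "Idl (u ` F) = carrier T" using T.genideal_closed(4)[OF uF] by blast
    then show "\<exists>u w. (\<forall>a\<in>F. u a \<in> carrier R \<and> a \<otimes> u a = w) \<and> Idl (u ` F) = carrier T"
      using uR au by blast
  qed
qed

theorem theorem6p8:
  fixes T R :: "('a, 'b) ring_scheme" and C :: "'a set"
    and Ds :: "('d, 'e) ring_scheme list"
  assumes square: "regular_conductor_square T R C"
    and flat: "flat_module TYPE('a) R (mult_module T (carrier T))"
    and principal: "principalideal C T"
    and cond: "\<And>I. fin_gen_ideal R I \<Longrightarrow> I \<noteq> {\<zero>\<^bsub>R\<^esub>} \<Longrightarrow>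
      \<exists>r\<in>carrier R. \<exists>s\<in>carrier R. \<exists>U. ideal U R \<and>
        Idl\<^bsub>T\<^esub> U = carrier T \<and> PIdl\<^bsub>T\<^esub> r = carrier T \<and>
        r <#\<^bsub>R\<^esub> I = s <#\<^bsub>R\<^esub> U \<and>
        (\<lambda>x. r \<otimes>\<^bsub>R\<^esub> x) \<in> module_iso R (mult_module R I) (mult_module R (r <#\<^bsub>R\<^esub> I)) \<and>
        (\<lambda>x. s \<otimes>\<^bsub>R\<^esub> x) \<in> module_iso R (mult_module R U) (mult_module R (s <#\<^bsub>R\<^esub> U))"
    and domains: "\<And>D. D \<in> set Ds \<Longrightarrow> domain D"
    and A_product: "R Quot C \<simeq> RDirProd_list Ds"
  shows "(quasi_coherent R \<longleftrightarrow> quasi_coherent (R Quot C)) \<and>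
         (quasi_coherent R \<longrightarrow> quasi_coherent T)"
proof -
  have cs: "conductor_square T R C" using square by (rule regular_conductor_square.axioms(1))
  interpret domain_conductor_square T R C
  proof (rule domain_conductor_squareI[OF square])
    fix I assume I: "fin_gen_ideal R I" "I \<noteq> {\<zero>\<^bsub>T\<^esub>}"
    then have "I \<noteq> {\<zero>\<^bsub>R\<^esub>}" by (simp add: conductor_square.sub_simps(4)[OF cs])
    \<comment> \<open>Injectivity of multiplication by \<open>s\<close> on \<open>U\<close> is part
      of its being a module isomorphism.\<close>
    from cond[OF I(1) this] show "\<exists>r\<in>carrier R. \<exists>s\<in>carrier R. \<exists>U. ideal U R \<and>
        Idl\<^bsub>T\<^esub> U = carrier T \<and> r <#\<^bsub>R\<^esub> I = s <#\<^bsub>R\<^esub> U \<and> inj_on (\<lambda>x. s \<otimes>\<^bsub>R\<^esub> x) U"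
      unfolding module_iso_def mult_module_def bij_betw_def by auto
  qed
  have "pp_ring (R Quot C)"
    by (rule pp_ring_iso[OF A.ring_axioms _ A_product])
       (use pp_ring_RDirProd_list[OF domains] in auto)
  then show ?thesis
    using quasi_coherent_quotientI quasi_coherent_subringI quasi_coherent_T by blast
qed

end
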